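(* Let $s$ be a composition and $\mathrm h$ an admissible height function for the DKK triangulation of $\mathcal F_{\mathcal O(s)}(\mathbf i)$. The vertices of $\mathrm{Perm}_s(\mathrm h)$ are in bijection with Stirling $s$-permutations, and the vertex $\mathbf v(w)=(\mathbf v(w)_a)_{a\in[n]}$ associated with a Stirling $s$-permutation $w$ has coordinates $$\mathbf v(w)_a=\sum_{t=1}^{s_a}\Big(\mathrm h\big(R[w_{[\ell(a^t)]}]\big)-\mathrm h\big(R[w_{[\ell(a^t)+1]}]\big)\Big),$$ where $\ell(a^t)$ is the length of the prefix of $w$ preceding the $t$-th occurrence of $a$.
   Context: $s=(s_1,\dots,s_n)$ positive integers, $|s|=\sum s_i$, $s_{n+1}:=2$. Stirling $s$-permutation: rearrangement of $1^{s_1}\cdots n^{s_n}$ avoiding the pattern $121$; $w_{[i]}$ is its prefix of length $i$. Graph $\mathcal O(s)$: vertices $v_{-1},\dots,v_n$; source edges $e^i_1,\dots,e^i_{s_i-1}$ from $v_{-1}$ to $v_{n+1-i}$ ($i\in[n+1]$); bump $e^i_0$ and dip $e^i_{s_i}$ from $v_{n-i}$ to $v_{n+1-i}$ ($i\in[n]$); framing: incoming at $v_{n+1-i}$: $e^i_0\prec e^i_1\prec\cdots\prec e^i_{s_i}$; outgoing at $v_{n+1-i}$: $e^{i-1}_0\prec e^{i-1}_{s_{i-1}}$. Routes $R(k,t,\delta)$ ($k\in[n+1]$, $t\in[s_k-1]$, $\delta\in\{0,1\}^{k-1}$) have edges $e^k_t,e^{k-1}_{\delta_{k-1}s_{k-1}},\dots,e^1_{\delta_1s_1}$.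 Coherence: on each maximal common subpath $v_a\cdots v_b$ ($v_a\ne v_{-1}$, $v_b\ne v_n$), $P$'s entering edge at $v_a$ precedes $Q$'s iff $P$'s leaving edge at $v_b$ precedes $Q$'s. The DKK triangulation of $\mathcal F_{\mathcal O(s)}(\mathbf i)=\mathrm{conv}\{\mathbf 1_R\}$ consists of simplices $\mathrm{conv}\{\mathbf 1_R:R\in C\}$, $C$ pairwise coherent; $\mathrm h$ is admissible if lifting $\mathbf 1_R$ to height $\mathrm h(R)$ and projecting lower faces yields it. For a prefix $u$: $t_a$ = number of $a$'s in $u$; $c$ least $a\in[n]$ with $0<t_a<s_a$ (else $c=n+1$, $t_{n+1}=1$); $R[u]:=R(c,t_c,(t_1/s_1,\dots,t_{c-1}/s_{c-1}))$. For $k\in[2,n+1]$, $t\in[s_k-1]$: $F^k_t(\mathbf x)=\min_{\delta\in\{0,1\}^{k-1}}(\mathrm h(R(k,t,\delta))+\sum_{i<k}\delta_ix_i)$, $\mathbf x\in\mathbb R^n$, with tropical hypersurface $\mathcal T(F^k_t)$ (where the minimum is attained at least twice). $\mathrm{Perm}_s(\mathrm h)$ is the polyhedral complex of bounded cells of the subdivision of $\mathbb R^n$ induced by the arrangement of all $\mathcal T(F^k_t)$. *)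

theory Defs
  imports "HOL-Analysis.Analysis" "HOL-Analysis.Finite_Function_Topology"
begin

(* A composition s = (s_1, ..., s_n) is a list of positive integers with n = length s. *)

definition composition :: "nat list \<Rightarrow> bool" where
  "composition s \<longleftrightarrow> (\<forall>a\<in>set s. 0 < a)"

(* part s i is s_i for 1 \<le> i \<le> n, and s_{n+1} = 2; other indices are never used. *)

definition part :: "nat list \<Rightarrow> nat \<Rightarrow> nat" where
  "part s i = (s @ [2]) ! (i - 1)"


section \<open>Stirling permutations\<close>

definition avoids_121 :: "nat list \<Rightarrow> bool" where
  "avoids_121 w \<longleftrightarrow>
     \<not> (\<exists>i j k. i < j \<and> j < k \<and> k < length w \<and> w ! i = w ! k \<and> w ! i < w ! j)"

definition stirling_perms :: "nat list \<Rightarrow> nat list set" where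
  "stirling_perms s =
     {w. mset w = (\<Sum>a\<in>{1..length s}. replicate_mset (part s a) a) \<and> avoids_121 w}"

(* The length of the prefix of w preceding the t-th occurrence of a (t \<ge> 1),
   i.e. the 0-based position of that occurrence. *)

definition occ_pos :: "nat list \<Rightarrow> nat \<Rightarrow> nat \<Rightarrow> nat" where
  "occ_pos w a t = filter (\<lambda>i. w ! i = a) [0..<length w] ! (t - 1)"


section \<open>The oruga graph, its framing and its routes\<close>

(* The edge e^i_j is the pair (i, j); the vertex v_m is the integer m, -1 \<le> m \<le> n. *)

type_synonym edge = "nat \<times> nat"
type_synonym route = "edge list"

definition edges :: "nat list \<Rightarrow> edge set" where
  "edges s = {(i, j). i \<in> {1..length s + 1} \<and> j \<in> {1..part s i - 1}}
           \<union> {(i, j). i \<in> {1..length s} \<and> j \<in> {0, part s i}}"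

definition tail :: "nat list \<Rightarrow> edge \<Rightarrow> int" where
  "tail s = (\<lambda>(i, j). if 0 < j \<and> j < part s i then -1 else int (length s) - int i)"

definition head :: "nat list \<Rightarrow> edge \<Rightarrow> int" where
  "head s = (\<lambda>(i, j). int (length s) + 1 - int i)"

(* The framing. It is only ever used to compare two edges entering the same vertex, or two
   edges leaving the same vertex other than v_{-1}; such edges share the same superscript, and
   in both cases the framing orders them by subscript. *)

definition precedes :: "edge \<Rightarrow> edge \<Rightarrow> bool" where
  "precedes e f \<longleftrightarrow> snd e < snd f"

definition routes :: "nat list \<Rightarrow> route set" where
  "routes s = {P. P \<noteq> [] \<and> set P \<subseteq> edges s
                \<and> tail s (hd P) = -1 \<and> head s (last P) = int (length s)
                \<and> successively (\<lambda>e f. head s e = tail s f) P}"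

(* M below is a maximal common subpath, from head e = head e' to tail f = tail f'
   (a single vertex if M = []). The vertex v_{-1} is never its start since e, e' precede it,
   and v_n is never its end since f, f' follow it. *)

definition coherent :: "nat list \<Rightarrow> route \<Rightarrow> route \<Rightarrow> bool" where
  "coherent s P Q \<longleftrightarrow>
     (\<forall>P1 e M f P2 Q1 e' f' Q2.
        P = P1 @ [e] @ M @ [f] @ P2 \<and> Q = Q1 @ [e'] @ M @ [f'] @ Q2 \<and>
        head s e = head s e' \<and> e \<noteq> e' \<and> f \<noteq> f' \<longrightarrow>
        (precedes e e' \<longleftrightarrow> precedes f f'))"


section \<open>The DKK triangulation and admissible height functions\<close>

definition route_vec :: "route \<Rightarrow> edge \<Rightarrow>\<^sub>0 real" where
  "route_vec P = (\<Sum>e\<in>set P. Poly_Mapping.single e 1)"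

definition DKK :: "nat list \<Rightarrow> (edge \<Rightarrow>\<^sub>0 real) set set" where
  "DKK s = {convex hull (route_vec ` C) | C.
              C \<noteq> {} \<and> C \<subseteq> routes s \<and> (\<forall>P\<in>C. \<forall>Q\<in>C. coherent s P Q)}"

definition lifted :: "nat list \<Rightarrow> (route \<Rightarrow> real) \<Rightarrow> ((edge \<Rightarrow>\<^sub>0 real) \<times> real) set" where
  "lifted s h = convex hull ((\<lambda>P. (route_vec P, h P)) ` routes s)"

(* The lower faces are the nonempty faces on which some linear functional whose coefficient
   on the height coordinate is positive (normalised to 1) is minimised. *)

definition lower_faces ::
  "('a::real_vector \<times> real) set \<Rightarrow> ('a \<times> real) set set" where
  "lower_faces X = {F. F \<noteq> {} \<and>
     (\<exists>c. linear c \<and> F = {p\<in>X. \<forall>q\<in>X. c (fst p) + snd p \<le> c (fst q) + snd q})}"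

definition admissible :: "nat list \<Rightarrow> (route \<Rightarrow> real) \<Rightarrow> bool" where
  "admissible s h \<longleftrightarrow> (\<lambda>F. fst ` F) ` lower_faces (lifted s h) = DKK s"


section \<open>The routes R(k, t, \<delta>) and R[u]\<close>

(* The edges are listed along the path, in order of decreasing superscript. *)

definition route_of :: "nat list \<Rightarrow> nat \<Rightarrow> nat \<Rightarrow> (nat \<Rightarrow> nat) \<Rightarrow> route" where
  "route_of s k t \<delta> = (k, t) # map (\<lambda>i. (i, \<delta> i * part s i)) (rev [1..<k])"

definition prefix_index :: "nat list \<Rightarrow> nat list \<Rightarrow> nat" where
  "prefix_index s u =
     (if \<exists>a\<in>{1..length s}. 0 < count_list u a \<and> count_list u a < part s a
      then LEAST a. a \<in> {1..length s} \<and> 0 < count_list u a \<and> count_list u a < part s a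
      else length s + 1)"

(* For i < prefix_index s u the count of i in a prefix u of a Stirling permutation is 0 or s_i,
   so the division below is exact. *)

definition prefix_route :: "nat list \<Rightarrow> nat list \<Rightarrow> route" where
  "prefix_route s u =
     (let c = prefix_index s u
      in route_of s c (if c = length s + 1 then 1 else count_list u c)
           (\<lambda>i. count_list u i div part s i))"


section \<open>The arrangement of tropical hypersurfaces\<close>

(* R^n with coordinates indexed by 1, ..., n. *)

definition Rn :: "nat \<Rightarrow> (nat \<Rightarrow>\<^sub>0 real) set" where
  "Rn n = {x. Poly_Mapping.keys x \<subseteq> {1..n}}"

definition binary :: "nat \<Rightarrow> (nat \<Rightarrow> nat) set" where
  "binary k = (\<Pi>\<^sub>E i\<in>{1..<k}. {0, 1})"

definition trop_term ::
  "nat list \<Rightarrow> (route \<Rightarrow> real) \<Rightarrow> nat \<Rightarrow> nat \<Rightarrow> (nat \<Rightarrow>\<^sub>0 real) \<Rightarrow> (nat \<Rightarrow> nat) \<Rightarrow> real" where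
  "trop_term s h k t x \<delta> =
     h (route_of s k t \<delta>) + (\<Sum>i\<in>{1..<k}. real (\<delta> i) * Poly_Mapping.lookup x i)"

definition trop_poly ::
  "nat list \<Rightarrow> (route \<Rightarrow> real) \<Rightarrow> nat \<Rightarrow> nat \<Rightarrow> (nat \<Rightarrow>\<^sub>0 real) \<Rightarrow> real" where
  "trop_poly s h k t x = Min (trop_term s h k t x ` binary k)"

definition trop_hypersurface ::
  "nat list \<Rightarrow> (route \<Rightarrow> real) \<Rightarrow> nat \<Rightarrow> nat \<Rightarrow> (nat \<Rightarrow>\<^sub>0 real) set" where
  "trop_hypersurface s h k t = {x \<in> Rn (length s). \<exists>\<delta>\<in>binary k. \<exists>\<epsilon>\<in>binary k. \<delta> \<noteq> \<epsilon> \<and>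
     trop_term s h k t x \<delta> = trop_poly s h k t x \<and>
     trop_term s h k t x \<epsilon> = trop_poly s h k t x}"

definition arrangement :: "nat list \<Rightarrow> (route \<Rightarrow> real) \<Rightarrow> (nat \<Rightarrow>\<^sub>0 real) set set" where
  "arrangement s h =
     {trop_hypersurface s h k t | k t. k \<in> {2..length s + 1} \<and> t \<in> {1..part s k - 1}}"

(* The subdivision of R^n induced by an arrangement of tropical hypersurfaces: the maximal cells
   are the closures of the regions of the complement (these are convex polyhedra), and the cells
   are the nonempty faces of the maximal cells. *)

definition induced_cells :: "nat \<Rightarrow> (nat \<Rightarrow>\<^sub>0 real) set set \<Rightarrow> (nat \<Rightarrow>\<^sub>0 real) set set" where
  "induced_cells n \<T> =
     {F. F \<noteq> {} \<and> (\<exists>U\<in>components (Rn n - \<Union>\<T>). F face_of closure U)}"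

definition Perm :: "nat list \<Rightarrow> (route \<Rightarrow> real) \<Rightarrow> (nat \<Rightarrow>\<^sub>0 real) set set" where
  "Perm s h = {F \<in> induced_cells (length s) (arrangement s h). bounded F}"

definition complex_vertices :: "'a set set \<Rightarrow> 'a set" where
  "complex_vertices K = {x. {x} \<in> K}"

end

theory Submission
  imports Defs "HOL-Library.Nat_Bijection"
begin

text \<open>A route is determined by its levels \<open>f i\<close> at the superscripts \<open>i \<le> k\<close>, and two routes are
  coherent iff their levels are comparable on the common superscripts. Hence the routes of the
  prefixes of a Stirling permutation \<open>w\<close> form a clique \<open>C\<^sub>w\<close>, and conversely every clique lies in
  some \<open>C\<^sub>w\<close>. By the Cayley trick, admissibility says that the sets of routes attaining the minima
  of all \<open>F\<^sup>k\<^sub>t\<close> at a point are cliques and that \<open>C\<^sub>w\<close> is exactly such a set for some point. The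
  equations imposed by \<open>C\<^sub>w\<close> on that point telescope to the stated coordinates, so they determine
  it and it is a vertex. If \<open>x\<close> is any vertex, its clique lies in some \<open>C\<^sub>w\<close>, and then the line
  through \<open>x\<close> and \<open>v w\<close> stays in the cell of \<open>x\<close> near \<open>x\<close>, which forces \<open>x = v w\<close>.\<close>

section \<open>Routes as level functions\<close>

text \<open>No dimensions, cliques or words are counted. A point \<open>x\<close> of
  \<open>Rn\<close> is a vertex exactly when no other point has an active set containing that of
  \<open>x\<close> (\<open>vertex_if_determined\<close>, \<open>vertex_determined\<close>), so both
  halves of the bijection come down to inclusions between sets of routes. The obstacle in using
  admissibility is that it concerns one minimum over all routes, while every
  \<open>F\<^sup>k\<^sub>t\<close> has a minimum of its own. A linear functional on edge space
  bridges this: the dip weight minus the bump weight at superscript \<open>i\<close> plays the role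
  of \<open>x i\<close>, and all other weights merge into one constant per pair
  \<open>(k, t)\<close>, which the weight of the source edge \<open>(k, t)\<close> can shift freely.
  Going back from a functional to a point, the constants are known to be the negated minima only if
  the clique has a route for every \<open>(k, t)\<close>; for \<open>C\<^sub>w\<close> this is
  \<open>prefix_routes_hit\<close>.\<close>

definition lpath :: "nat \<Rightarrow> (nat \<Rightarrow> nat) \<Rightarrow> route" where
  "lpath k f = map (\<lambda>i. (i, f i)) (rev [1..<Suc k])"

text \<open>Subscripts are recorded instead of bits, so that letter counts of prefixes serve
  directly as levels and coherence becomes a comparison of numbers.\<close>

definition profile :: "nat list \<Rightarrow> nat \<Rightarrow> (nat \<Rightarrow> nat) \<Rightarrow> bool" where
  "profile s k f \<longleftrightarrow> k \<in> {1..length s + 1} \<and> f k \<in> {1..part s k - 1} \<and>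
     (\<forall>i\<in>{1..<k}. f i \<in> {0, part s i})"

lemma lpath_0 [simp]: "lpath 0 f = []"
  by (simp add: lpath_def)

lemma lpath_Suc [simp]: "lpath (Suc k) f = (Suc k, f (Suc k)) # lpath k f"
  by (simp add: lpath_def)

lemma length_lpath [simp]: "length (lpath k f) = k"
  by (simp add: lpath_def)

lemma nth_lpath: "i < k \<Longrightarrow> lpath k f ! i = (k - i, f (k - i))"
  by (simp add: lpath_def rev_nth Suc_diff_Suc del: upt_Suc)

lemma last_lpath: "1 \<le> k \<Longrightarrow> last (lpath k f) = (1, f 1)"
  by (simp add: lpath_def last_map last_rev upt_conv_Cons del: upt_Suc)

lemma set_lpath: "set (lpath k f) = (\<lambda>i. (i, f i)) ` {1..k}"
  by (auto simp: lpath_def)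

lemma lpath_cong: "k = k' \<Longrightarrow> (\<And>i. i \<in> {1..k} \<Longrightarrow> f i = g i) \<Longrightarrow> lpath k f = lpath k' g"
  by (auto simp: lpath_def)

lemma lpath_eqD:
  assumes "lpath k f = lpath k' g"
  shows "k = k'" and "\<And>i. i \<in> {1..k} \<Longrightarrow> f i = g i"
proof -
  show k: "k = k'"
    using assms by (metis length_lpath)
  fix i assume "i \<in> {1..k}"
  then have "(i, f i) \<in> set (lpath k' g)"
    unfolding assms[symmetric] by (auto simp: set_lpath)
  then show "f i = g i"
    by (auto simp: set_lpath)
qed

lemma part_pos:
  assumes "composition s" "i \<in> {1..length s + 1}"
  shows "0 < part s i"
proof (cases "i = length s + 1")
  case False
  then have "s ! (i - 1) \<in> set s"
    using assms(2) by (intro nth_mem) auto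
  then show ?thesis
    using False assms by (auto simp: part_def composition_def nth_append)
qed (auto simp: part_def nth_append)

lemma part_last: "part s (Suc (length s)) = 2"
  by (simp add: part_def nth_append)

lemma profile_last: "profile s (Suc (length s)) f \<Longrightarrow> f (Suc (length s)) = 1"
  by (auto simp: profile_def part_last)

text \<open>Heads have index at least 0, so no edge after the first can leave \<open>v_{-1}\<close>.
  Every later edge is therefore a bump or a dip, and matching its tail with the preceding head
  lowers the superscript by exactly one.\<close>

lemma walk_eq_lpath:
  assumes "successively (\<lambda>e f. head s e = tail s f) P" "P \<noteq> []" "set P \<subseteq> edges s"
    and "head s (last P) = int (length s)"
  shows "\<exists>f. P = lpath (fst (hd P)) f \<and> (\<forall>i\<in>{1..<fst (hd P)}. f i \<in> {0, part s i})"
  using assms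
proof (induction P rule: induct_list012)
  case (2 e)
  then have "fst e = 1"
    by (cases e) (auto simp: head_def)
  then show ?case
    by (intro exI[of _ "\<lambda>_. snd e"]) (cases e, auto simp: lpath_def)
next
  case (3 e e' P)
  obtain k v k' v' where e: "e = (k, v)" "e' = (k', v')"
    by (cases e, cases e') auto
  obtain f where f: "e' # P = lpath k' f" "\<forall>i\<in>{1..<k'}. f i \<in> {0, part s i}"
    using 3 by (auto simp: e)
  have he: "head s e = tail s e'" and ed: "e \<in> edges s" "e' \<in> edges s"
    using 3 by auto
  have "k \<le> length s + 1" "k' \<ge> 1"
    using ed by (auto simp: edges_def e)
  then have k: "k = Suc k'" and v': "\<not> (0 < v' \<and> v' < part s k')"
    using he by (auto simp: e head_def tail_def split: if_splits)
  have "v' \<in> {0, part s k'}"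
    using ed(2) v' by (auto simp: e edges_def)
  moreover have "v' = f k'"
    using f(1) \<open>k' \<ge> 1\<close> by (cases k') (auto simp: e)
  ultimately have "\<forall>i\<in>{1..<k}. f i \<in> {0, part s i}"
    using f(2) by (auto simp: k less_Suc_eq)
  moreover have "lpath k' (f(k := v)) = lpath k' f"
    by (rule lpath_cong) (auto simp: k)
  ultimately have "e # e' # P = lpath k (f(k := v)) \<and>
      (\<forall>i\<in>{1..<k}. (f(k := v)) i \<in> {0, part s i})"
    using f(1) by (simp add: e k del: fun_upd_apply) simp
  then show ?case
    unfolding e list.sel fst_conv by (intro exI[of _ "f(k := v)"])
qed auto

lemma successively_lpath:
  assumes "composition s" "k \<le> length s + 1" "\<forall>i\<in>{1..<k}. f i \<in> {0, part s i}"
  shows "successively (\<lambda>e f. head s e = tail s f) (lpath k f)"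
  using assms
proof (induction k)
  case (Suc k)
  then have "successively (\<lambda>e f. head s e = tail s f) (lpath k f)"
    by auto
  moreover have "f k \<in> {0, part s k}" if "k \<ge> 1"
    using Suc.prems(3) that by auto
  ultimately show ?case
    by (cases k) (auto simp: successively_Cons head_def tail_def)
qed auto

lemma routes_eq:
  assumes "composition s"
  shows "routes s = {lpath k f | k f. profile s k f}"
proof (intro set_eqI iffI)
  fix P assume P: "P \<in> routes s"
  obtain k v where hd: "hd P = (k, v)"
    by (cases "hd P") auto
  have ne: "P \<noteq> []" and sub: "set P \<subseteq> edges s" and t: "tail s (hd P) = -1"
    using P by (auto simp: routes_def)
  have "hd P \<in> edges s"
    using sub ne by auto
  then have kv: "k \<in> {1..length s + 1}" "v \<in> {1..part s k - 1}"
    using t by (auto simp: hd edges_def tail_def split: if_splits)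
  obtain f where f: "P = lpath k f" "\<forall>i\<in>{1..<k}. f i \<in> {0, part s i}"
    using walk_eq_lpath[of s P] P by (auto simp: routes_def hd)
  have "f k = v"
    using f(1) hd kv by (cases k) auto
  then show "P \<in> {lpath k f | k f. profile s k f}"
    using f kv by (auto simp: profile_def)
next
  fix P assume "P \<in> {lpath k f | k f. profile s k f}"
  then obtain k f where P: "P = lpath k f" and pr: "profile s k f"
    by auto
  then obtain k' where k: "k = Suc k'" "k \<le> length s + 1"
    by (cases k) (auto simp: profile_def)
  have "(i, f i) \<in> edges s" if "i \<in> {1..k}" for i
    using that pr by (cases "i = k") (fastforce simp: edges_def profile_def)+
  then have "set P \<subseteq> edges s"
    by (auto simp: P set_lpath)
  moreover have "successively (\<lambda>e f. head s e = tail s f) P"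
    using successively_lpath[OF assms, of k f] pr by (auto simp: P profile_def)
  moreover have "tail s (hd P) = -1"
    using pr by (auto simp: P k profile_def tail_def)
  moreover have "last P = (1, f 1)"
    using k by (simp only: P last_lpath)
  ultimately show "P \<in> routes s"
    using k by (auto simp: routes_def P head_def)
qed

section \<open>Comparing two routes: source edges and coherence\<close>

lemma profile_unique_level:
  assumes "profile s k f" "profile s k' g" "k \<le> k'" "f k = g k"
  shows "k = k'"
proof (rule ccontr)
  assume "k \<noteq> k'"
  then have "k < k'"
    using assms(3) by simp
  \<comment> \<open>Only the source edge of a route has a level strictly between the extremes, so a
    shared source level cannot lie below the top of either route.\<close>
  then have "g k \<in> {0, part s k}" "f k \<in> {1..part s k - 1}"
    using assms(1,2) by (simp_all add: profile_def)
  then show False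
    using assms(4) by auto
qed

text \<open>The head of an edge determines its superscript, and superscripts drop by one along a
  route. So the two copies of \<open>M\<close> sit at the same superscripts, and so do the edges
  leaving them.\<close>

lemma lpath_aligned:
  assumes P: "lpath k f = P1 @ [e] @ M @ [d] @ P2" and Q: "lpath k' g = Q1 @ [e'] @ M @ [d'] @ Q2"
    and h: "head s e = head s e'"
  obtains i j where "i \<in> {1..min k k'}" "j \<in> {1..min k k'}"
    "e = (i, f i)" "e' = (i, g i)" "d = (j, f j)" "d' = (j, g j)"
proof -
  have l: "k = length P1 + length M + 2 + length P2" "k' = length Q1 + length M + 2 + length Q2"
    using arg_cong[OF P, of length] arg_cong[OF Q, of length] by auto
  have "e = lpath k f ! length P1" "e' = lpath k' g ! length Q1"
    "d = lpath k f ! (length P1 + length M + 1)" "d' = lpath k' g ! (length Q1 + length M + 1)"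
    unfolding P Q by (auto simp: nth_append)
  moreover have "length P1 < k" "length Q1 < k'" "length P1 + length M + 1 < k"
    "length Q1 + length M + 1 < k'"
    using l by simp_all
  ultimately have "e = (k - length P1, f (k - length P1))" "e' = (k' - length Q1, g (k' - length Q1))"
    "d = (k - (length P1 + length M + 1), f (k - (length P1 + length M + 1)))"
    "d' = (k' - (length Q1 + length M + 1), g (k' - (length Q1 + length M + 1)))"
    by (simp_all only: nth_lpath)
  moreover from this have "k - length P1 = k' - length Q1"
    using h by (auto simp: head_def)
  moreover from this have "k - (length P1 + length M + 1) = k' - (length Q1 + length M + 1)"
    using l by linarith
  ultimately show thesis
    using l by (intro that[of "k - length P1" "k - (length P1 + length M + 1)"]) auto
qed

text \<open>Wherever the levels differ, those of the first route are strictly smaller, so both sides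
  of the coherence condition hold. In the mirrored statement below both sides fail.\<close>

lemma coherent_if_le:
  assumes "\<And>i. i \<in> {1..min k k'} \<Longrightarrow> f i \<le> g i"
  shows "coherent s (lpath k f) (lpath k' g)"
  unfolding coherent_def
proof (intro allI impI, elim conjE)
  fix P1 e M d P2 Q1 e' d' Q2
  assume A: "lpath k f = P1 @ [e] @ M @ [d] @ P2" "lpath k' g = Q1 @ [e'] @ M @ [d'] @ Q2"
    "head s e = head s e'" and ne: "e \<noteq> e'" "d \<noteq> d'"
  obtain i j where "i \<in> {1..min k k'}" "j \<in> {1..min k k'}"
    "e = (i, f i)" "e' = (i, g i)" "d = (j, f j)" "d' = (j, g j)"
    by (rule lpath_aligned[OF A])
  then show "precedes e e' \<longleftrightarrow> precedes d d'"
    using assms[of i] assms[of j] ne by (simp add: precedes_def)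
qed

lemma coherent_if_ge:
  assumes "\<And>i. i \<in> {1..min k k'} \<Longrightarrow> g i \<le> f i"
  shows "coherent s (lpath k f) (lpath k' g)"
  unfolding coherent_def
proof (intro allI impI, elim conjE)
  fix P1 e M d P2 Q1 e' d' Q2
  assume A: "lpath k f = P1 @ [e] @ M @ [d] @ P2" "lpath k' g = Q1 @ [e'] @ M @ [d'] @ Q2"
    "head s e = head s e'" and ne: "e \<noteq> e'" "d \<noteq> d'"
  obtain i j where "i \<in> {1..min k k'}" "j \<in> {1..min k k'}"
    "e = (i, f i)" "e' = (i, g i)" "d = (j, f j)" "d' = (j, g j)"
    by (rule lpath_aligned[OF A])
  then show "precedes e e' \<longleftrightarrow> precedes d d'"
    using assms[of i] assms[of j] ne by (simp add: precedes_def)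
qed

lemma lpath_split:
  assumes "1 \<le> l" "l < i" "i \<le> k"
  shows "lpath k f = map (\<lambda>i. (i, f i)) (rev [Suc i..<Suc k]) @ [(i, f i)] @
    map (\<lambda>i. (i, f i)) (rev [Suc l..<i]) @ [(l, f l)] @ map (\<lambda>i. (i, f i)) (rev [1..<l])"
proof -
  have "[1..<Suc k] = [1..<l] @ [l..<i] @ [i..<Suc k]"
    using upt_add_eq_append[of 1 l "Suc k - l"] upt_add_eq_append[of l i "Suc k - i"] assms by simp
  also have "[l..<i] = l # [Suc l..<i]" 
    using assms by (simp add: upt_conv_Cons)
  also have "[i..<Suc k] = i # [Suc i..<Suc k]"
    using assms by (simp add: upt_conv_Cons del: upt_Suc)
  finally show ?thesis
    unfolding lpath_def by (simp del: upt_Suc)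
qed

text \<open>Coherence only compares the two ends of a common subpath. A disagreement strictly
  between \<open>l\<close> and \<open>i\<close> splits the interval and induction applies to both
  pieces; without one, the edges in between form such a subpath.\<close>

lemma coherent_sign:
  assumes "coherent s (lpath k f) (lpath k' g)" "1 \<le> l" "l < i" "i \<le> min k k'"
    and "f i \<noteq> g i" "f l \<noteq> g l"
  shows "f i < g i \<longleftrightarrow> f l < g l"
  using assms
proof (induction "i - l" arbitrary: i l rule: less_induct)
  case less
  show ?case
  proof (cases "\<exists>m. l < m \<and> m < i \<and> f m \<noteq> g m")
    case True
    then obtain m where m: "l < m" "m < i" "f m \<noteq> g m"
      by blast
    then have "f i < g i \<longleftrightarrow> f m < g m" "f m < g m \<longleftrightarrow> f l < g l"
      using less.prems by (intro less.hyps; auto)+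
    then show ?thesis
      by simp
  next
    case False
    have M: "map (\<lambda>i. (i, f i)) (rev [Suc l..<i]) = map (\<lambda>i. (i, g i)) (rev [Suc l..<i])"
      using False by auto
    have "i \<le> k" "i \<le> k'"
      using less.prems by auto
    note sp = lpath_split[OF less.prems(2,3) this(1), of f]
      lpath_split[OF less.prems(2,3) this(2), of g, folded M]
    have "precedes (i, f i) (i, g i) \<longleftrightarrow> precedes (l, f l) (l, g l)"
      using less.prems(1)[unfolded coherent_def, rule_format, OF conjI, OF sp(1) conjI, OF sp(2)] 
        less.prems(5,6) by (auto simp: head_def)
    then show ?thesis
      by (simp add: precedes_def)
  qed
qed

lemma coherent_comparable:
  assumes "coherent s (lpath k f) (lpath k' g)" "i \<in> {1..min k k'}" "f i < g i"
    and "l \<in> {1..min k k'}"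
  shows "f l \<le> g l"
  using assms coherent_sign[of s k f k' g l i] coherent_sign[of s k f k' g i l]
  by (cases l i rule: linorder_cases) (force intro: leI)+

section \<open>Prefixes of Stirling words\<close>

text \<open>Words on the letters \<open>m, ..., n\<close> only: \<open>m = n + 1\<close> leaves the
  empty word and \<open>m = 1\<close> gives the Stirling permutations, with the insertion of one
  block leading from \<open>m + 1\<close> to \<open>m\<close>.\<close>

definition stirling_words :: "nat list \<Rightarrow> nat \<Rightarrow> nat list set" where
  "stirling_words s m =
     {w. (\<forall>a. count_list w a = (if a \<in> {m..length s} then part s a else 0)) \<and> avoids_121 w}"

lemma stirling_perms_eq: "stirling_perms s = stirling_words s 1"
proof -
  have "mset w = (\<Sum>a\<in>{1..length s}. replicate_mset (part s a) a) \<longleftrightarrow>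
      (\<forall>a. count_list w a = (if a \<in> {1..length s} then part s a else 0))" for w
    by (simp add: multiset_eq_iff count_sum count_mset)
  then show ?thesis
    unfolding stirling_perms_def stirling_words_def by blast
qed

section \<open>Letter counts in prefixes\<close>

lemma count_take_Suc:
  "p < length w \<Longrightarrow>
    count_list (take (Suc p) w) a = count_list (take p w) a + (if w ! p = a then 1 else 0)"
  by (simp add: take_Suc_conv_app_nth)

lemma count_take_mono: "p \<le> q \<Longrightarrow> count_list (take p w) a \<le> count_list (take q w) a"
  by (metis count_list_append le_add1 le_add_diff_inverse take_add)

lemma count_take_le: "count_list (take p w) a \<le> count_list w a"
  by (metis append_take_drop_id count_list_append le_add1)

lemma count_take_part_le:
  "w \<in> stirling_words s m \<Longrightarrow> count_list (take p w) a \<le> part s a"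
  using count_take_le[of p w a] by (auto simp: stirling_words_def split: if_splits)

lemma nth_in_letters:
  assumes "w \<in> stirling_words s m" "p < length w"
  shows "w ! p \<in> {m..length s}"
proof -
  have "count_list w (w ! p) \<noteq> 0"
    using assms(2) by (simp add: count_list_0_iff)
  then show ?thesis
    using assms(1) by (auto simp: stirling_words_def split: if_splits)
qed

text \<open>An occurrence of \<open>b\<close> on each side of a larger letter would be a pattern
  121. Hence just before a letter is read, every smaller letter is either untouched or used
  up.\<close>

lemma smaller_letter_closed:
  assumes "avoids_121 w" "p < length w" "b < w ! p"
  shows "count_list (take p w) b = 0 \<or> count_list (take p w) b = count_list w b"
proof (rule ccontr)
  assume *: "\<not> ?thesis"
  then have "b \<in> set (take p w)"
    by (simp add: count_list_0_iff)
  then obtain i where i: "i < p" "w ! i = b"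
    by (auto simp: in_set_conv_nth)
  have "count_list w b = count_list (take p w) b + count_list (drop p w) b"
    by (metis append_take_drop_id count_list_append)
  then have "count_list (drop p w) b \<noteq> 0"
    using * by auto
  then have "b \<in> set (drop p w)"
    using count_notin by metis
  then obtain k where "k < length (drop p w)" "drop p w ! k = b"
    by (auto simp only: in_set_conv_nth)
  then have k: "p + k < length w" "w ! (p + k) = b"
    by auto
  then have "p < p + k"
    using assms(3) by (cases k) auto
  then have "\<not> avoids_121 w"
    using i k assms(3) unfolding avoids_121_def not_not
    by (intro exI[of _ i] exI[of _ p] exI[of _ "p + k"]) simp
  then show False
    using assms(1) by contradiction
qed

text \<open>The letter \<open>n + 1\<close> does not occur in words. Since
  \<open>s_{n+1} = 2\<close>, its only source edge has subscript 1, which is the level set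
  here.\<close>

definition level :: "nat list \<Rightarrow> nat list \<Rightarrow> nat \<Rightarrow> nat" where
  "level s u i = (if i = length s + 1 then 1 else count_list u i)"

section \<open>Partly used letters and the route of a prefix\<close>

abbreviation is_open :: "nat list \<Rightarrow> nat list \<Rightarrow> nat \<Rightarrow> bool" where
  "is_open s u a \<equiv> 0 < count_list u a \<and> count_list u a < part s a"

lemma prefix_index_eqI:
  assumes "k \<in> {1..length s + 1}" "k \<le> length s \<Longrightarrow> is_open s u k"
    and "\<And>i. i \<in> {1..<k} \<Longrightarrow> \<not> is_open s u i"
  shows "prefix_index s u = k"
proof (cases "k = length s + 1")
  case True
  then have "\<not> (\<exists>a\<in>{1..length s}. is_open s u a)"
    using assms(3) by force
  then show ?thesis
    unfolding prefix_index_def True by (rule if_not_P)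
next
  case False
  then have k: "k \<in> {1..length s}" "is_open s u k"
    using assms by auto
  then have "(LEAST a. a \<in> {1..length s} \<and> is_open s u a) = k"
  proof (intro Least_equality)
    fix y assume "y \<in> {1..length s} \<and> is_open s u y"
    then show "k \<le> y"
      using assms(3)[of y] by (cases "k \<le> y") auto
  qed (use k in auto)
  moreover have "\<exists>a\<in>{1..length s}. is_open s u a"
    using k by blast
  ultimately show ?thesis
    unfolding prefix_index_def by (simp only: if_True)
qed

lemma prefix_index_props:
  shows "prefix_index s u \<in> {1..length s + 1}"
    and "prefix_index s u \<le> length s \<Longrightarrow> is_open s u (prefix_index s u)"
    and "i \<in> {1..<prefix_index s u} \<Longrightarrow> \<not> is_open s u i"
proof -
  have *: "prefix_index s u \<in> {1..length s + 1} \<and>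
    (prefix_index s u \<le> length s \<longrightarrow> is_open s u (prefix_index s u)) \<and>
    (\<forall>i\<in>{1..<prefix_index s u}. \<not> is_open s u i)"
  proof (cases "\<exists>a\<in>{1..length s}. is_open s u a")
    case True
    then have eq: "prefix_index s u = (LEAST a. a \<in> {1..length s} \<and> is_open s u a)"
      by (simp add: prefix_index_def)
    obtain a where "a \<in> {1..length s} \<and> is_open s u a"
      using True by blast
    from LeastI[of "\<lambda>a. a \<in> {1..length s} \<and> is_open s u a", OF this]
    have l: "prefix_index s u \<in> {1..length s}" "is_open s u (prefix_index s u)"
      unfolding eq by auto
    have "\<not> is_open s u i" if "i \<in> {1..<prefix_index s u}" for i
      using not_less_Least[of i "\<lambda>a. a \<in> {1..length s} \<and> is_open s u a"] that l(1)
      unfolding eq by auto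
    then show ?thesis
      using l by auto
  next
    case False
    then show ?thesis
      by (auto simp: prefix_index_def)
  qed
  then show "prefix_index s u \<in> {1..length s + 1}"
    "prefix_index s u \<le> length s \<Longrightarrow> is_open s u (prefix_index s u)"
    "i \<in> {1..<prefix_index s u} \<Longrightarrow> \<not> is_open s u i"
    by blast+
qed

lemma count_div_part:
  assumes "composition s" "i \<in> {1..<prefix_index s u}" "count_list u i \<le> part s i"
  shows "count_list u i \<in> {0, part s i}" "count_list u i div part s i \<in> {0, 1}"
    "count_list u i div part s i * part s i = count_list u i"
proof -
  show "count_list u i \<in> {0, part s i}"
    using prefix_index_props(3)[OF assms(2)] assms(3) by auto
  then show "count_list u i div part s i \<in> {0, 1}"
    "count_list u i div part s i * part s i = count_list u i"
    by (cases "part s i = 0"; auto)+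
qed

lemma prefix_route_eq:
  assumes "composition s" "\<And>a. a \<in> {1..length s} \<Longrightarrow> count_list u a \<le> part s a"
  shows "prefix_route s u = lpath (prefix_index s u) (level s u)"
proof -
  define c where "c = prefix_index s u"
  have c: "c \<in> {1..length s + 1}"
    using prefix_index_props(1) by (simp add: c_def)
  have "lpath c (level s u) = (c, level s u c) # lpath (c - 1) (level s u)"
    using c by (cases c) auto
  also have "lpath (c - 1) (level s u) =
      map (\<lambda>i. (i, count_list u i div part s i * part s i)) (rev [1..<c])"
    using c count_div_part(3)[OF assms(1)] assms(2)
    by (cases c) (auto simp: lpath_def level_def c_def[symmetric] simp del: upt_Suc)
  also have "level s u c = (if c = length s + 1 then 1 else count_list u c)"
    by (rule level_def)
  finally show ?thesis
    unfolding prefix_route_def Let_def route_of_def c_def[symmetric] by (rule sym)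
qed

lemma prefix_profile:
  assumes "composition s" "\<And>a. a \<in> {1..length s} \<Longrightarrow> count_list u a \<le> part s a"
  shows "profile s (prefix_index s u) (level s u)"
proof -
  note p = prefix_index_props[where s = s and u = u]
  have "level s u i \<in> {0, part s i}" if "i \<in> {1..<prefix_index s u}" for i
  proof -
    have "i \<in> {1..length s}"
      using that p(1) by auto
    then show ?thesis
      using count_div_part(1)[OF assms(1) that assms(2)] by (simp add: level_def)
  qed
  moreover have "level s u (prefix_index s u) \<in> {1..part s (prefix_index s u) - 1}"
  proof (cases "prefix_index s u = length s + 1")
    case False
    then have "prefix_index s u \<le> length s"
      using p(1) by auto
    then show ?thesis
      using p(2) False by (auto simp: level_def)
  qed (simp add: level_def part_last)
  ultimately show ?thesis
    using p(1) by (simp add: profile_def)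
qed

section \<open>The clique of a word, and why it determines the word\<close>

lemma prefix_routes_coherent:
  assumes "composition s" "w \<in> stirling_words s 1"
  shows "coherent s (prefix_route s (take p w)) (prefix_route s (take q w))"
proof -
  have eq: "prefix_route s (take r w) = lpath (prefix_index s (take r w)) (level s (take r w))" for r
    using assms count_take_part_le by (intro prefix_route_eq) auto
  show ?thesis
  \<comment> \<open>Letter counts grow with the prefix, so the shorter prefix has the smaller levels
    throughout.\<close>
  proof (cases "p \<le> q")
    case True
    then show ?thesis
      unfolding eq by (intro coherent_if_le) (auto simp: level_def count_take_mono)
  next
    case False
    then show ?thesis
      unfolding eq by (intro coherent_if_ge) (auto simp: level_def count_take_mono)
  qed
qed

lemma prefix_route_in_routes:
  assumes "composition s" "w \<in> stirling_words s 1"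
  shows "prefix_route s (take p w) \<in> routes s"
  using prefix_route_eq[OF assms(1), of "take p w"] prefix_profile[OF assms(1), of "take p w"]
    count_take_part_le[OF assms(2)] routes_eq[OF assms(1)] by blast

text \<open>Suppose \<open>w\<close> continues with \<open>a\<close> and \<open>w'\<close> with a
  larger \<open>b\<close>. The route after reading \<open>b\<close> records one more
  \<open>b\<close> and no further \<open>a\<close>. A prefix of \<open>w\<close> with this route
  must be longer than the common part, because of \<open>b\<close>, but then it also contains the
  extra \<open>a\<close>.\<close>

lemma next_letter_le_if_prefix_routes_subset:
  assumes s: "composition s" and w: "w \<in> stirling_words s 1" and w': "w' \<in> stirling_words s 1"
    and sub: "\<And>p. p \<le> length w' \<Longrightarrow> \<exists>q\<le>length w. prefix_route s (take p w') = prefix_route s (take q w)"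
    and p: "take p w = take p w'" "p < length w" "p < length w'"
  shows "w' ! p \<le> w ! p"
proof (rule ccontr)
  assume "\<not> ?thesis"
  then have lt: "w ! p < w' ! p"
    by simp
  define a b where "a = w ! p" and "b = w' ! p"
  define u where "u = take (Suc p) w'"
  have ab: "a \<in> {1..length s}" "b \<in> {1..length s}" "a < b"
    using nth_in_letters[OF w p(2)] nth_in_letters[OF w' p(3)] lt by (auto simp: a_def b_def)
  have cu: "count_list u i = count_list (take p w) i + (if i = b then 1 else 0)" for i
    using count_take_Suc[OF p(3)] by (auto simp: u_def b_def p(1))
  have "\<not> is_open s u i" if "i \<in> {1..<b}" for i
  proof -
    have "count_list w' i = part s i"
      using w' that ab by (auto simp: stirling_words_def)
    then show ?thesis
      using smaller_letter_closed[of w' p i] w' p that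
      by (auto simp: stirling_words_def cu b_def)
  qed
  \<comment> \<open>This makes the route of \<open>u\<close> record the counts of all letters up to
    \<open>b\<close>, in particular those of both \<open>a\<close> and \<open>b\<close>.\<close>
  then have "b \<le> prefix_index s u"
    using prefix_index_props(1,2)[where s = s and u = u] ab by (force simp: not_less)
  obtain q where q: "q \<le> length w" "prefix_route s u = prefix_route s (take q w)"
    using sub[of "Suc p"] p(3) by (auto simp: u_def)
  have "lpath (prefix_index s u) (level s u) = lpath (prefix_index s (take q w)) (level s (take q w))"
    using q(2) prefix_route_eq[OF s, of u] prefix_route_eq[OF s, of "take q w"]
      count_take_part_le[OF w] count_take_part_le[OF w'] by (simp add: u_def)
  from lpath_eqD(2)[OF this] have eq: "level s u i = level s (take q w) i" if "i \<in> {1..b}" for i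
    using that \<open>b \<le> prefix_index s u\<close> by auto
  have "count_list (take q w) b = count_list (take p w) b + 1"
    using eq[of b] ab by (simp add: level_def cu)
  then have "p < q"
    using count_take_mono[of q p w b] by (cases "p < q") auto
  then have "count_list (take (Suc p) w) a \<le> count_list (take q w) a"
    by (intro count_take_mono) auto
  moreover have "count_list (take (Suc p) w) a = count_list (take p w) a + 1"
    using count_take_Suc[OF p(2)] by (simp add: a_def)
  moreover have "count_list (take q w) a = count_list (take p w) a"
    using eq[of a] ab by (simp add: level_def cu)
  ultimately show False
    by simp
qed

text \<open>Equal cliques allow the comparison of next letters in both directions, so the words
  agree letter by letter.\<close>

lemma stirling_word_eqI:
  assumes s: "composition s" and w: "w \<in> stirling_words s 1" and w': "w' \<in> stirling_words s 1"
    and eq: "(\<lambda>p. prefix_route s (take p w)) ` {..length w} = (\<lambda>p. prefix_route s (take p w')) ` {..length w'}"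
  shows "w = w'"
proof -
  have "count_list w a = count_list w' a" for a
    using w w' by (simp add: stirling_words_def)
  then have "mset w = mset w'"
    by (simp add: multiset_eq_iff count_mset)
  then have len: "length w = length w'"
    by (rule mset_eq_length)
  have "take p w = take p w'" if "p \<le> length w" for p
    using that
  proof (induction p)
    case (Suc p)
    have p: "p < length w" "p < length w'"
      using Suc.prems by (simp_all only: len[symmetric] Suc_le_eq)
    then have t: "take p w = take p w'"
      using Suc.IH by (simp only: less_imp_le)
    have 1: "\<exists>q\<le>length w. prefix_route s (take r w') = prefix_route s (take q w)" if "r \<le> length w'" for r
      using that eq by (metis (no_types, lifting) atMost_iff image_iff)
    have 2: "\<exists>q\<le>length w'. prefix_route s (take r w) = prefix_route s (take q w')" if "r \<le> length w" for r
      using that eq by (metis (no_types, lifting) atMost_iff image_iff)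
    have "w' ! p \<le> w ! p" "w ! p \<le> w' ! p"
      by (rule next_letter_le_if_prefix_routes_subset[OF s w w' 1 t p]
        next_letter_le_if_prefix_routes_subset[OF s w' w 2 t[symmetric] p(2,1)], assumption)+
    then have "w ! p = w' ! p"
      by (rule antisym[rotated])
    then show ?case
      unfolding take_Suc_conv_app_nth[OF p(1)] take_Suc_conv_app_nth[OF p(2)] t by simp
  qed simp
  from this[of "length w"] show ?thesis
    using len by (metis order_refl take_all)
qed

section \<open>Recovering a word from a clique\<close>

lemma avoids_121_insert_block:
  assumes "avoids_121 w" "\<And>a. a \<in> set w \<Longrightarrow> m < a" and q: "q \<le> length w"
  shows "avoids_121 (take q w @ replicate r m @ drop q w)"
proof -
  define w' where "w' = take q w @ replicate r m @ drop q w"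
  \<comment> \<open>Translates positions outside the inserted block back to positions of
    \<open>w\<close>.\<close>
  define f where "f i = (if i < q then i else i - r)" for i
  have len: "length w' = length w + r"
    using q by (simp add: w'_def)
  have out: "w' ! i = w ! f i \<and> f i < length w" if "i < length w'" "\<not> (q \<le> i \<and> i < q + r)" for i
    using that q by (auto simp: w'_def f_def nth_append len[unfolded w'_def] nth_Cons')
  have inb: "w' ! i = m" if "q \<le> i" "i < q + r" for i
    using that q by (auto simp: w'_def nth_append)
  have big: "m < w' ! i" if "i < length w'" "\<not> (q \<le> i \<and> i < q + r)" for i
    using out[OF that] assms(2) by (metis nth_mem)
  show ?thesis
    unfolding avoids_121_def w'_def[symmetric]
  proof (rule notI, elim exE conjE)
    fix i j k assume ijk: "i < j" "j < k" "k < length w'" "w' ! i = w' ! k" "w' ! i < w' ! j"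
    show False
    \<comment> \<open>If the outer letters are the minimal letter \<open>m\<close>, all three
      positions lie in the block and the middle letter is not larger. Otherwise the middle letter
      also exceeds \<open>m\<close>, so the whole pattern already occurs in
      \<open>w\<close>.\<close>
    proof (cases "q \<le> i \<and> i < q + r")
      case True
      then have "w' ! k = m"
        using inb ijk by auto
      then have "q \<le> k \<and> k < q + r"
        using big ijk by (metis less_irrefl)
      then have "w' ! j = m"
        using True ijk by (intro inb) auto
      then show False
        using inb True ijk by auto
    next
      case False
      then have i: "m < w' ! i"
        using big[of i] ijk False by auto
      then have nb: "\<not> (q \<le> k \<and> k < q + r)" "\<not> (q \<le> j \<and> j < q + r)"
        using inb[of k] inb[of j] ijk by (auto dest: less_trans)
      have "f i < f j" "f j < f k"
        using False nb ijk by (auto simp: f_def)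
      moreover have "w ! f i = w ! f k" "w ! f i < w ! f j" "f k < length w"
        using out[of i] out[of j] out[of k] False nb ijk by auto
      ultimately show False
        using assms(1) unfolding avoids_121_def by blast
    qed
  qed
qed

lemma count_list_replicate: "count_list (replicate n x) y = (if x = y then n else 0)"
  by (induction n) auto

text \<open>The smallest letter of a Stirling word forms a block, so the word is found by inserting
  the blocks of the letters \<open>n, \<dots>, 1\<close> in turn. The position of the block of \<open>m\<close> separates
  the routes of the clique with level \<open>0\<close> at \<open>m\<close> from those with level \<open>s\<^sub>m\<close>.\<close>

lemma clique_matches_word:
  assumes s: "composition s"
    and coh: "\<And>P Q. P \<in> C \<Longrightarrow> Q \<in> C \<Longrightarrow> coherent s P Q"
    and m: "1 \<le> m" "m \<le> length s + 1"
  shows "\<exists>w\<in>stirling_words s m. \<forall>k f. profile s k f \<longrightarrow> lpath k f \<in> C \<longrightarrow> m \<le> k \<longrightarrow>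
    (\<exists>p\<le>length w. \<forall>i\<in>{m..k}. i \<le> length s \<longrightarrow> count_list (take p w) i = f i)"
  using m(2,1)
proof (induction m rule: inc_induct)
  case base
  have "[] \<in> stirling_words s (length s + 1)"
    by (auto simp: stirling_words_def avoids_121_def)
  then show ?case
    by (intro bexI[of _ "[]"]) auto
next
  case (step m)
  define matches where "matches k f p w \<longleftrightarrow>
    (\<forall>i\<in>{Suc m..k}. i \<le> length s \<longrightarrow> count_list (take p w) i = f i)" for k and f :: "nat \<Rightarrow> nat" and p w
  obtain w where w: "w \<in> stirling_words s (Suc m)"
    and wC: "\<And>k f. profile s k f \<Longrightarrow> lpath k f \<in> C \<Longrightarrow> Suc m \<le> k \<Longrightarrow> \<exists>p\<le>length w. matches k f p w"
    using step.IH unfolding matches_def by auto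
  \<comment> \<open>The block of \<open>m\<close> has to come after some matching position of every
    route at level 0, so it goes to the last matching position of such a route. If there is none,
    any position serves and 0 is chosen.\<close>
  define S where "S = {p. p \<le> length w \<and> (\<exists>k f. profile s k f \<and> lpath k f \<in> C \<and> m < k \<and> f m = 0 \<and> matches k f p w)}"
  define q where "q = (if S = {} then 0 else Max S)"
  have finS: "finite S"
    by (rule finite_subset[of _ "{..length w}"]) (auto simp: S_def)
  have qS: "q \<in> S" if "S \<noteq> {}"
    using that finS by (simp add: q_def)
  have q: "q \<le> length w"
    using qS by (cases "S = {}") (auto simp: q_def S_def)
  have m: "1 \<le> m" "m \<le> length s"
    using step by auto
  then have sm: "0 < part s m"
    using part_pos[OF s] by auto
  have low: "\<exists>p\<le>q. matches k f p w"
    if f: "profile s k f" "lpath k f \<in> C" "m < k" "f m = 0" for k f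
  proof -
    obtain p where p: "p \<le> length w" "matches k f p w"
      using wC[of k f] f by auto
    then have "p \<in> S"
      using p f by (auto simp: S_def)
    then have "p \<le> q"
      using finS by (auto simp: q_def)
    then show ?thesis
      using p by blast
  qed
  have high: "\<exists>p\<ge>q. p \<le> length w \<and> matches k f p w"
    if f: "profile s k f" "lpath k f \<in> C" "m < k" "f m = part s m" for k f
  proof -
    obtain p where p: "p \<le> length w" "matches k f p w"
      using wC[of k f] f by auto
    \<comment> \<open>If \<open>f\<close> was matched too early, let \<open>g\<close> be the route
      at level 0 that realises \<open>q\<close>. The earlier position gives
      \<open>f i \<le> g i\<close>, and coherence, with \<open>g m < f m\<close>, gives
      \<open>g i \<le> f i\<close>. So the routes agree above \<open>m\<close>, have the same source
      edge, and \<open>q\<close> matches \<open>f\<close> as well.\<close>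
    show ?thesis
    proof (cases "q \<le> p")
      case False
      then have "S \<noteq> {}"
        by (auto simp: q_def)
      then obtain k' g where g: "profile s k' g" "lpath k' g \<in> C" "m < k'" "g m = 0" "matches k' g q w"
        using qS by (auto simp: S_def)
      have eq: "f i = g i" if i: "i \<in> {m<..min k k'}" for i
      proof (cases "i \<le> length s")
        case True
        have "f i \<le> g i"
          using p(2) g(5) True i False count_take_mono[of p q w i] by (auto simp: matches_def)
        moreover have "g i \<le> f i"
          using coherent_comparable[OF coh[OF g(2) f(2)], of m i] f g sm m i by auto
        ultimately show ?thesis
          by simp
      next
        case False
        then have "k = Suc (length s)" "k' = Suc (length s)" "i = Suc (length s)"
          using i f(1) g(1) by (auto simp: profile_def)
        then show ?thesis
          using f(1) g(1) profile_last[of s f] profile_last[of s g] by simp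
      qed
      have "k = k'"
        using profile_unique_level[OF f(1) g(1)] profile_unique_level[OF g(1) f(1)] eq[of k] eq[of k'] f(3) g(3)
        by (cases "k \<le> k'") auto
      then have "matches k f q w"
        using g(5) eq by (auto simp: matches_def)
      then show ?thesis
        using q by blast
    qed (use p in blast)
  qed
  define w' where "w' = take q w @ replicate (part s m) m @ drop q w"
  have count_w: "count_list w' i = count_list w i + (if m = i then part s m else 0)" for i
  proof -
    have "count_list w i = count_list (take q w) i + count_list (drop q w) i"
      by (metis append_take_drop_id count_list_append)
    then show ?thesis
      by (simp add: w'_def count_list_replicate)
  qed
  have gt: "m < a" if "a \<in> set w" for a
    using that nth_in_letters[OF w] by (metis Suc_le_eq atLeastAtMost_iff in_set_conv_nth)
  have "avoids_121 w'"
    unfolding w'_def using w gt q by (intro avoids_121_insert_block) (auto simp: stirling_words_def)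
  then have w': "w' \<in> stirling_words s m"
    using w m by (auto simp: stirling_words_def count_w)
  have len: "length w' = length w + part s m"
    using q by (simp add: w'_def)
  have low': "count_list (take p w') i = count_list (take p w) i" if "p \<le> q" for p i
    using that q by (simp add: w'_def min_def)
  have mid': "count_list (take (q + t) w') i = count_list (take q w) i + (if m = i then t else 0)"
    if "t \<le> part s m" for t i
    using that q by (auto simp: w'_def count_list_replicate min_def)
  have high': "count_list (take (p + part s m) w') i = count_list (take p w) i + (if m = i then part s m else 0)"
    if "q \<le> p" for p i
  proof -
    have "take p w = take q w @ take (p - q) (drop q w)"
      using that by (metis le_add_diff_inverse take_add)
    moreover obtain r where "p = q + r"
      using \<open>q \<le> p\<close> le_Suc_ex by blast
    then have "take (p + part s m) w' = take q w @ replicate (part s m) m @ take (p - q) (drop q w)"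
      using q by (simp add: w'_def min.absorb1 min.absorb2 take_drop)
    ultimately show ?thesis
      by (simp add: count_list_replicate)
  qed
  have cm: "count_list (take p w) m = 0" for p
    using gt count_take_le[of p w m] count_notin[of m w] by fastforce
  have agree: "\<forall>i\<in>{m..k}. i \<le> length s \<longrightarrow> count_list u i = f i"
    if "count_list u m = f m" "\<And>i. i \<in> {Suc m..k} \<Longrightarrow> i \<le> length s \<Longrightarrow> count_list u i = f i"
    for u k and f :: "nat \<Rightarrow> nat"
  proof (intro ballI impI)
    fix i assume "i \<in> {m..k}" "i \<le> length s"
    then show "count_list u i = f i"
      using that by (cases "i = m") auto
  qed
  have "\<exists>p\<le>length w'. \<forall>i\<in>{m..k}. i \<le> length s \<longrightarrow> count_list (take p w') i = f i"
    if f: "profile s k f" "lpath k f \<in> C" "m \<le> k" for k f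
  proof -
    have "f m \<in> {0, part s m}" if "m < k"
      using f(1) m that by (simp add: profile_def)
    then consider "k = m" | "m < k" "f m = 0" | "m < k" "f m = part s m"
      using f(3) le_neq_implies_less by blast
    then show ?thesis
    proof cases
      \<comment> \<open>Only the count of \<open>m\<close> matters here, so the prefix may stop
        inside the new block after \<open>f m\<close> copies.\<close>
      case 1
      then have fm: "f m \<le> part s m"
        using f(1) by (auto simp: profile_def)
      then have "\<forall>i\<in>{m..k}. i \<le> length s \<longrightarrow> count_list (take (q + f m) w') i = f i"
        using 1 mid'[OF fm] cm by auto
      then show ?thesis
        using fm q len by (intro exI[of _ "q + f m"]) auto
    next
      case 2
      then obtain p where p: "p \<le> q" "matches k f p w"
        using low f by blast
      then have "\<forall>i\<in>{m..k}. i \<le> length s \<longrightarrow> count_list (take p w') i = f i"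
        using 2 cm low'[OF p(1)] p(2) by (intro agree) (auto simp: matches_def)
      then show ?thesis
        using p(1) q len by (intro exI[of _ p]) auto
    next
      case 3
      then obtain p where p: "q \<le> p" "p \<le> length w" "matches k f p w"
        using high f by blast
      then have "\<forall>i\<in>{m..k}. i \<le> length s \<longrightarrow> count_list (take (p + part s m) w') i = f i"
        using 3 cm high'[OF p(1)] p(3) by (intro agree) (auto simp: matches_def)
      then show ?thesis
        using p len by (intro exI[of _ "p + part s m"]) auto
    qed
  qed
  then show ?case
    using w' by blast
qed

text \<open>Equal counts suffice for equal routes: the level at \<open>k\<close> lies strictly
  between the extremes and those below \<open>k\<close> do not, so \<open>k\<close> is the least
  partly used letter of the matching prefix.\<close>

lemma clique_subset_prefix_routes:
  assumes s: "composition s" and C: "C \<subseteq> routes s"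
    and coh: "\<And>P Q. P \<in> C \<Longrightarrow> Q \<in> C \<Longrightarrow> coherent s P Q"
  shows "\<exists>w\<in>stirling_words s 1. C \<subseteq> (\<lambda>p. prefix_route s (take p w)) ` {..length w}"
proof -
  obtain w where w: "w \<in> stirling_words s 1" 
    and m: "\<And>k f. profile s k f \<Longrightarrow> lpath k f \<in> C \<Longrightarrow> 1 \<le> k \<Longrightarrow>
    (\<exists>p\<le>length w. \<forall>i\<in>{1..k}. i \<le> length s \<longrightarrow> count_list (take p w) i = f i)"
    using clique_matches_word[OF s coh, of C 1] by auto
  have "P \<in> (\<lambda>p. prefix_route s (take p w)) ` {..length w}" if "P \<in> C" for P
  proof -
    obtain k f where P: "P = lpath k f" and f: "profile s k f"
      using \<open>P \<in> C\<close> C unfolding routes_eq[OF s] by blast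
    have k: "k \<in> {1..length s + 1}"
      using f by (auto simp: profile_def)
    obtain p where p: "p \<le> length w" "\<And>i. i \<in> {1..k} \<Longrightarrow> i \<le> length s \<Longrightarrow> count_list (take p w) i = f i"
      using m[OF f] \<open>P \<in> C\<close> P k by auto
    have "prefix_index s (take p w) = k"
    proof (rule prefix_index_eqI[OF k])
      assume "k \<le> length s"
      moreover have "f k \<in> {1..part s k - 1}"
        using f by (simp add: profile_def)
      ultimately show "is_open s (take p w) k"
        using p(2)[of k] k by auto
    next
      fix i assume i: "i \<in> {1..<k}"
      then have "f i \<in> {0, part s i}"
        using f by (auto simp: profile_def)
      then show "\<not> is_open s (take p w) i"
        using p(2)[of i] i k by auto
    qed
    then have "prefix_route s (take p w) = lpath k (level s (take p w))"
      using prefix_route_eq[OF s] count_take_part_le[OF w] by simp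
    also have "\<dots> = P"
      unfolding P using p(2) k profile_last[of s f] f by (intro lpath_cong) (auto simp: level_def)
    finally show ?thesis
      using p(1) by auto
  qed
  then show ?thesis
    using w by blast
qed

section \<open>Vertex coordinates\<close>

lemma filter_occurrences:
  "length (filter (\<lambda>i. w ! i = a) [0..<length w]) = count_list w a"
  "t < count_list w a \<Longrightarrow>
    occ_pos w a (Suc t) < length w \<and> w ! occ_pos w a (Suc t) = a \<and>
    count_list (take (occ_pos w a (Suc t)) w) a = t"
proof (induction w rule: rev_induct)
  case (snoc x w)
  have eq: "filter (\<lambda>i. (w @ [x]) ! i = a) [0..<length (w @ [x])] =
      filter (\<lambda>i. w ! i = a) [0..<length w] @ (if x = a then [length w] else [])"
    by (auto intro!: filter_cong simp: nth_append)
  {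
    case 1
    show ?case
      unfolding eq using snoc.IH(1) by simp
  next
    case 2
    show ?case
    proof (cases "t < count_list w a")
      case True
      then have "occ_pos (w @ [x]) a (Suc t) = occ_pos w a (Suc t)"
        unfolding occ_pos_def eq using snoc.IH(1) by (simp add: nth_append)
      then show ?thesis
        using snoc.IH(2)[OF True] by (simp add: nth_append)
    next
      case False
      then have "x = a" "t = count_list w a"
        using 2 by (auto split: if_splits)
      then have "occ_pos (w @ [x]) a (Suc t) = length w"
        unfolding occ_pos_def eq using snoc.IH(1) by (simp add: nth_append)
      then show ?thesis
        using \<open>x = a\<close> \<open>t = count_list w a\<close> by simp
    qed
  }
qed auto

lemma occ_pos_props:
  assumes "t \<in> {1..count_list w a}"
  shows "occ_pos w a t < length w" "w ! occ_pos w a t = a" "count_list (take (occ_pos w a t) w) a = t - 1"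
  using filter_occurrences(2)[of "t - 1" w a] assms by auto

lemma count_take_eqI:
  assumes "p \<le> q" "q \<le> length w" "\<And>j. p \<le> j \<Longrightarrow> j < q \<Longrightarrow> w ! j \<noteq> b"
  shows "count_list (take q w) b = count_list (take p w) b"
  using assms by (induction q rule: dec_induct) (auto simp: count_take_Suc)

text \<open>A larger letter between two equal ones would be a pattern 121, so nothing above
  \<open>a\<close> changes from the first to the last \<open>a\<close>.\<close>

lemma larger_letter_outside:
  assumes "avoids_121 w" "p < length w" "q < length w" "p \<le> q" "w ! p = w ! q" "w ! p < b"
  shows "count_list (take (Suc q) w) b = count_list (take p w) b"
proof (rule count_take_eqI)
  fix j assume j: "p \<le> j" "j < Suc q"
  show "w ! j \<noteq> b"
  proof
    assume "w ! j = b"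
    then have "j \<noteq> p" "j \<noteq> q" "w ! p < w ! j"
      using assms by auto
    then have "\<not> avoids_121 w"
      using j assms(3,5) unfolding avoids_121_def not_not
      by (intro exI[of _ p] exI[of _ j] exI[of _ q]) simp
    then show False
      using assms(1) by contradiction
  qed
qed (use assms in auto)

text \<open>The values of \<open>h\<close> along the prefixes telescope: the contributions of the letters smaller
  than \<open>a\<close> are unchanged by an occurrence of \<open>a\<close>, and what surrounds the block of \<open>a\<close> is the
  same before its first and after its last occurrence, so that only \<open>x a\<close> survives.\<close>

lemma prefix_route_telescope:
  fixes h :: "route \<Rightarrow> real" and x :: "nat \<Rightarrow> real" and Y :: "nat \<Rightarrow> nat \<Rightarrow> real"
  assumes s: "composition s" and w: "w \<in> stirling_words s 1" and a: "a \<in> {1..length s}"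
    and pot: "\<And>p. p \<le> length w \<Longrightarrow> h (prefix_route s (take p w)) =
      - (Y (prefix_index s (take p w)) (level s (take p w) (prefix_index s (take p w))) +
        (\<Sum>i\<in>{1..<prefix_index s (take p w)}. real (count_list (take p w) i div part s i) * x i))"
  shows "(\<Sum>t\<in>{1..part s a}. h (prefix_route s (take (occ_pos w a t) w))
      - h (prefix_route s (take (occ_pos w a t + 1) w))) = x a"
proof -
  define S where "S = part s a"
  define p where "p = occ_pos w a"
  define d where "d u i = real (count_list u i div part s i) * x i" for u i
  define V where "V u = Y (prefix_index s u) (level s u (prefix_index s u)) +
    (\<Sum>i\<in>{1..<prefix_index s u}. d u i)" for u
  define D where "D u = (\<Sum>i\<in>{1..<a}. d u i)" for u
  define u1 where "u1 = take (p 1) w"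
  define k0 where "k0 = prefix_index s u1"
  define Y' where "Y' = Y k0 (level s u1 k0) + (\<Sum>i\<in>{a<..<k0}. d u1 i)"
  \<comment> \<open>The part of \<open>V\<close> that depends on how many copies \<open>t\<close> of
    \<open>a\<close> have been read. While \<open>a\<close> is partly used, it carries the source
    edge; before the first and after the last copy the source edge is at \<open>k0\<close>, and the
    bit of \<open>a\<close> switches from 0 to 1, which adds \<open>x a\<close>.\<close>
  define E where "E t = (if t = 0 then Y' else if t < S then Y a t else Y' + x a)" for t
  have av: "avoids_121 w" and cw: "\<And>b. b \<in> {1..length s} \<Longrightarrow> count_list w b = part s b"
    using w by (auto simp: stirling_words_def)
  have S: "0 < S" "count_list w a = S"
    using part_pos[OF s] a cw by (auto simp: S_def)
  have pt: "p t < length w" "w ! p t = a" "count_list (take (p t) w) a = t - 1"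
    "count_list (take (Suc (p t)) w) a = t" if "t \<in> {1..S}" for t
    using occ_pos_props[of t w a] that S count_take_Suc[of "p t" w a] by (auto simp: p_def)
  have lower: "\<not> is_open s (take (p t) w) b"
    "count_list (take (Suc (p t)) w) b = count_list (take (p t) w) b"
    if "t \<in> {1..S}" "b \<in> {1..<a}" for t b
  proof -
    show "\<not> is_open s (take (p t) w) b"
      using smaller_letter_closed[OF av, of "p t" b] pt[OF that(1)] that(2) cw[of b] a by auto
    show "count_list (take (Suc (p t)) w) b = count_list (take (p t) w) b"
      using count_take_Suc[of "p t" w b] pt[OF that(1)] that(2) by auto
  qed
  have "1 \<in> {1..S}" "S \<in> {1..S}"
    using S by auto
  note p1 = pt[OF this(1)] and pS = pt[OF this(2)] and low1 = lower[OF this(1)]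
  have "p 1 \<le> p S"
  proof (rule ccontr)
    assume "\<not> p 1 \<le> p S"
    then have "count_list (take (Suc (p S)) w) a \<le> count_list (take (p 1) w) a"
      by (intro count_take_mono) auto
    then show False
      using p1 pS S by simp
  qed
  then have upper: "count_list (take (Suc (p S)) w) b = count_list u1 b" if "a < b" for b
    unfolding u1_def using that p1 pS by (intro larger_letter_outside[OF av]) auto
  have k0: "k0 \<in> {1..length s + 1}" "k0 \<le> length s \<Longrightarrow> is_open s u1 k0"
    "\<And>i. i \<in> {1..<k0} \<Longrightarrow> \<not> is_open s u1 i"
    unfolding k0_def by (rule prefix_index_props; assumption?)+
  \<comment> \<open>Before its first occurrence \<open>a\<close> has count 0 and all smaller letters
    are untouched or used up.\<close>
  have "a < k0"
  proof (rule ccontr)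
    assume "\<not> a < k0"
    then have "k0 < a \<or> k0 = a" and "is_open s u1 k0"
      using k0 a by auto
    then show False
      using low1(1)[of k0] p1(3) k0(1) by (auto simp: u1_def)
  qed
  have V: "V u = E (count_list u a) + D u"
    if le: "count_list u a \<le> S"
      and lo: "\<And>b. b \<in> {1..<a} \<Longrightarrow> \<not> is_open s u b"
      and up: "\<And>b. count_list u a = 0 \<or> count_list u a = S \<Longrightarrow> a < b \<Longrightarrow> count_list u b = count_list u1 b" for u
  proof (cases "count_list u a = 0 \<or> count_list u a = S")
    case False
    then have op: "is_open s u a"
      using le by (auto simp: S_def)
    have "prefix_index s u = a"
      using a lo op by (intro prefix_index_eqI) auto
    then show ?thesis
      using False op a by (simp add: V_def E_def D_def S_def level_def)
  next
    case True
    note up = up[OF True]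
    have idx: "prefix_index s u = k0"
    proof (rule prefix_index_eqI[OF k0(1)])
      assume "k0 \<le> length s"
      then show "is_open s u k0"
        using k0(2) up[OF \<open>a < k0\<close>] by simp
    next
      fix i assume i: "i \<in> {1..<k0}"
      consider "i < a" | "i = a" | "a < i"
        by linarith
      then show "\<not> is_open s u i"
      proof cases
        case 1
        then show ?thesis
          using lo[of i] i by auto
      next
        case 2
        then show ?thesis
          using True by (auto simp: S_def)
      next
        case 3
        then show ?thesis
          using k0(3)[OF i] up[of i] by simp
      qed
    qed
    have "level s u k0 = level s u1 k0"
      using up[OF \<open>a < k0\<close>] by (simp add: level_def)
    moreover have "(\<Sum>i\<in>{1..<k0}. d u i) = D u + d u a + (\<Sum>i\<in>{a<..<k0}. d u i)"
    proof -
      have "{1..<k0} = {1..<a} \<union> ({a} \<union> {a<..<k0})"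
        using \<open>a < k0\<close> a by auto
      then show ?thesis
        by (simp add: D_def sum.union_disjoint ivl_disj_int) (subst sum.union_disjoint; auto)
    qed
    moreover have "(\<Sum>i\<in>{a<..<k0}. d u i) = (\<Sum>i\<in>{a<..<k0}. d u1 i)"
      using up by (intro sum.cong) (auto simp: d_def)
    moreover have "d u a = (if count_list u a = 0 then 0 else x a)"
      using True S by (auto simp: d_def S_def)
    ultimately show ?thesis
      using True S(1) by (auto simp: V_def idx Y'_def E_def)
  qed
  have step: "h (prefix_route s (take (p t) w)) - h (prefix_route s (take (p t + 1) w)) = E t - E (t - 1)"
    if t: "t \<in> {1..S}" for t
  proof -
    have "V (take (p t) w) = E (t - 1) + D (take (p t) w)"
    proof (subst V)
      \<comment> \<open>The count \<open>t - 1\<close> is below \<open>S\<close>, so the assumption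
        leaves only the first occurrence; for the longer prefix further on it leaves only the
        last.\<close>
      fix b assume *: "count_list (take (p t) w) a = 0 \<or> count_list (take (p t) w) a = S"
      have "t = 1"
        using * t pt(3)[OF t] by auto
      then show "count_list (take (p t) w) b = count_list u1 b"
        by (simp add: u1_def)
    qed (use pt[OF t] lower[OF t] t in auto)
    moreover have "V (take (Suc (p t)) w) = E t + D (take (Suc (p t)) w)"
    proof (subst V)
      fix b assume *: "count_list (take (Suc (p t)) w) a = 0 \<or> count_list (take (Suc (p t)) w) a = S"
        and "a < b"
      have "t = S"
        using * t pt(4)[OF t] by auto
      then show "count_list (take (Suc (p t)) w) b = count_list u1 b"
        using upper[OF \<open>a < b\<close>] by simp
    qed (use pt[OF t] lower[OF t] t in auto)
    moreover have "D (take (Suc (p t)) w) = D (take (p t) w)"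
      using lower(2)[OF t] by (simp add: D_def d_def)
    moreover have "h (prefix_route s (take q w)) = - V (take q w)" if "q \<le> length w" for q
      using pot[OF that] by (simp add: V_def d_def)
    ultimately show ?thesis
      using pt(1)[OF t] by simp
  qed
  have "(\<Sum>t\<in>{1..S}. h (prefix_route s (take (p t) w)) - h (prefix_route s (take (p t + 1) w))) =
      (\<Sum>t\<in>{Suc 0..S}. E t - E (t - 1))"
    using step by (intro sum.cong) auto
  also have "\<dots> = E S - E 0"
    by (rule sum_telescope'') simp
  also have "\<dots> = x a"
    using S by (simp add: E_def)
  finally show ?thesis
    by (simp add: S_def p_def)
qed

section \<open>Admissible heights\<close>

lemma route_of_eq_lpath:
  "1 \<le> k \<Longrightarrow> route_of s k t \<delta> = lpath k ((\<lambda>i. \<delta> i * part s i)(k := t))"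
  by (cases k) (auto simp: route_of_def lpath_def)

lemma finite_binary: "finite (binary k)"
  by (auto simp: binary_def intro: finite_PiE)

lemma binary_cases: "\<delta> \<in> binary k \<Longrightarrow> i \<in> {1..<k} \<Longrightarrow> \<delta> i = 0 \<or> \<delta> i = 1"
  by (auto simp: binary_def)

text \<open>The arrangement starts at \<open>k = 2\<close>, but \<open>k = 1\<close> is included
  here: \<open>F\<^sup>1\<^sub>t\<close> has a single term, so its route is active at every point,
  just as cliques of words contain those routes.\<close>

definition route_indices :: "nat list \<Rightarrow> (nat \<times> nat) set" where
  "route_indices s = Sigma {1..length s + 1} (\<lambda>k. {1..part s k - 1})"

lemma route_of_in_routes:
  assumes "composition s" "(k, t) \<in> route_indices s" "\<delta> \<in> binary k"
  shows "route_of s k t \<delta> \<in> routes s"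
proof -
  have k: "1 \<le> k" "k \<le> length s + 1" and t: "t \<in> {1..part s k - 1}"
    using assms(2) by (auto simp: route_indices_def)
  have "((\<lambda>i. \<delta> i * part s i)(k := t)) i \<in> {0, part s i}" if "i \<in> {1..<k}" for i
    using binary_cases[OF assms(3) that] that by auto
  then have "profile s k ((\<lambda>i. \<delta> i * part s i)(k := t))"
    using k t by (simp add: profile_def del: insert_iff)
  then show ?thesis
    unfolding route_of_eq_lpath[OF k(1)] routes_eq[OF assms(1)] by blast
qed

lemma routesE:
  assumes "composition s" "P \<in> routes s"
  obtains k t \<delta> where "(k, t) \<in> route_indices s" "\<delta> \<in> binary k" "P = route_of s k t \<delta>"
proof -
  obtain k f where P: "P = lpath k f" and f: "profile s k f"
    using assms(2) unfolding routes_eq[OF assms(1)] by blast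
  then have k: "1 \<le> k" "k \<le> length s + 1"
    by (auto simp: profile_def)
  \<comment> \<open>Members of \<open>binary k\<close> are extensional functions, hence the
    restriction; it makes the bit vector of a route unique.\<close>
  define \<delta> where "\<delta> = restrict (\<lambda>i. f i div part s i) {1..<k}"
  have d: "\<delta> i \<in> {0, 1} \<and> \<delta> i * part s i = f i" if "i \<in> {1..<k}" for i
  proof -
    have "f i \<in> {0, part s i}"
      using f that by (simp add: profile_def)
    moreover have "0 < part s i"
      using that k by (intro part_pos[OF assms(1)]) auto
    ultimately show ?thesis
      using that by (auto simp: \<delta>_def)
  qed
  have "(k, f k) \<in> route_indices s"
    using f by (auto simp: route_indices_def profile_def)
  moreover have "\<delta> \<in> binary k"
    unfolding binary_def using d by (intro PiE_I) (auto simp: \<delta>_def)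
  moreover have "P = route_of s k (f k) \<delta>"
    unfolding P route_of_eq_lpath[OF k(1)] using d by (intro lpath_cong) auto
  ultimately show thesis
    by (rule that)
qed

lemma route_of_eqD:
  assumes "composition s" "(k, t) \<in> route_indices s" "(k', t') \<in> route_indices s"
    and "\<delta> \<in> binary k" "\<delta>' \<in> binary k'" "route_of s k t \<delta> = route_of s k' t' \<delta>'"
  shows "k = k'" "t = t'" "\<delta> = \<delta>'"
proof -
  have k: "1 \<le> k" "1 \<le> k'" "k \<le> length s + 1"
    using assms by (auto simp: route_indices_def)
  note eq = assms(6)[unfolded route_of_eq_lpath[OF k(1)] route_of_eq_lpath[OF k(2)]]
  show kk: "k = k'"
    by (rule lpath_eqD(1)[OF eq])
  note eq = lpath_eqD(2)[OF eq]
  show "t = t'"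
    using eq[of k] k kk by simp
  show "\<delta> = \<delta>'"
  proof (rule PiE_ext)
    fix i assume i: "i \<in> {1..<k}"
    then have "0 < part s i"
      using k by (intro part_pos[OF assms(1)]) auto
    then show "\<delta> i = \<delta>' i"
      using eq[of i] i kk by auto
  qed (use assms(4,5) kk in \<open>auto simp: binary_def\<close>)
qed

lemma finite_route_indices: "finite (route_indices s)"
  by (simp add: route_indices_def)

lemma finite_edges: "finite (edges s)"
  by (rule finite_subset[of _ "Sigma {1..length s + 1} (\<lambda>i. {0..part s i})"]) (auto simp: edges_def)

text \<open>The source edge of \<open>P\<close> must be the source edge of \<open>Q\<close>, which
  forces equal lengths. This antichain property is what makes each route vector a vertex of the flow
  polytope.\<close>

lemma routes_inclusion_eq:
  assumes s: "composition s" and "P \<in> routes s" "Q \<in> routes s" "set P \<subseteq> set Q"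
  shows "P = Q"
proof -
  obtain k f k' g where P: "P = lpath k f" "profile s k f" and Q: "Q = lpath k' g" "profile s k' g"
    using assms(2,3) unfolding routes_eq[OF s] by blast
  have sub: "i \<le> k' \<and> f i = g i" if "i \<in> {1..k}" for i
  proof -
    have "(i, f i) \<in> set P"
      using that by (auto simp: P(1) set_lpath)
    then have "(i, f i) \<in> set Q"
      using assms(4) by blast
    then show ?thesis
      by (auto simp: Q(1) set_lpath)
  qed
  have "k \<in> {1..k}"
    using P by (auto simp: profile_def)
  from sub[OF this] have "k = k'"
    using profile_unique_level[OF P(2) Q(2)] by simp
  then show ?thesis
    unfolding P Q using sub by (intro lpath_cong) auto
qed

section \<open>Linear functionals and convex hulls of route vectors\<close>

lemma lookup_scaleR: "Poly_Mapping.lookup (r *\<^sub>R x) i = r *\<^sub>R Poly_Mapping.lookup x i"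
proof -
  have "finite {i. r *\<^sub>R Poly_Mapping.lookup x i \<noteq> 0}"
    by (rule finite_subset[OF _ finite_lookup[of x]]) auto
  then show ?thesis
    by (simp add: scaleR_poly_mapping_def)
qed

lemma lookup_route_vec: "Poly_Mapping.lookup (route_vec P) e = (if e \<in> set P then 1 else 0)"
  by (simp add: route_vec_def lookup_sum lookup_single when_def)

lemma linear_lookup_sum:
  fixes W :: "'a \<Rightarrow> real"
  shows "linear (\<lambda>x. \<Sum>e\<in>A. W e * Poly_Mapping.lookup x e)"
  by (intro linearI) (simp_all add: lookup_add lookup_scaleR distrib_left sum.distrib sum_distrib_left mult.left_commute)

lemma convex_hull_linear_less:
  fixes f :: "'a::real_vector \<Rightarrow> real"
  assumes "linear f" "\<And>x. x \<in> S \<Longrightarrow> f x < b" "x \<in> convex hull S"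
  shows "f x < b"
proof -
  have "convex hull S \<subseteq> f -` {..<b}"
    using assms(2) by (intro hull_minimal convex_linear_vimage assms(1) convex_real_interval) auto
  then show ?thesis
    using assms(3) by auto
qed

lemma convex_hull_linear_ge:
  fixes f :: "'a::real_vector \<Rightarrow> real"
  assumes "linear f" "\<And>x. x \<in> S \<Longrightarrow> b \<le> f x" "x \<in> convex hull S"
  shows "b \<le> f x"
proof -
  have "convex hull S \<subseteq> f -` {b..}"
    using assms(2) by (intro hull_minimal convex_linear_vimage assms(1) convex_real_interval) auto
  then show ?thesis
    using assms(3) by auto
qed

text \<open>An open half-space together with one point of its bounding hyperplane is still
  convex.\<close>

lemma convex_hull_exposed_point:
  fixes f :: "'a::real_vector \<Rightarrow> real"
  assumes f: "linear f" and lt: "\<And>x. x \<in> S \<Longrightarrow> x \<noteq> a \<Longrightarrow> f x < f a" and x: "x \<in> convex hull S"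
  shows "f x < f a \<or> x = a"
proof -
  let ?T = "{x. f x < f a \<or> x = a}"
  have "convex ?T"
  proof (rule convexI)
    fix x y and u v :: real
    assume xy: "x \<in> ?T" "y \<in> ?T" and uv: "0 \<le> u" "0 \<le> v" "u + v = 1"
    have eq: "f (u *\<^sub>R x + v *\<^sub>R y) = u * f x + v * f y"
      using f by (simp add: linear_add linear_scale)
    have le: "f x \<le> f a" "f y \<le> f a"
      using xy by auto
    have a: "f a = u * f a + v * f a"
      using uv(3) by (metis distrib_right mult_1)
    have "f (u *\<^sub>R x + v *\<^sub>R y) < f a" if "0 < u \<and> f x < f a \<or> 0 < v \<and> f y < f a"
    proof (cases "0 < u \<and> f x < f a")
      case True
      then have "u * f x < u * f a" "v * f y \<le> v * f a"
        using le uv by (auto intro: mult_left_mono mult_strict_left_mono)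
      then show ?thesis
        using eq a by linarith
    next
      case False
      then have "v * f y < v * f a" "u * f x \<le> u * f a"
        using le uv that by (auto intro: mult_left_mono mult_strict_left_mono)
      then show ?thesis
        using eq a by linarith
    qed
    moreover have "u *\<^sub>R x + v *\<^sub>R y = a" if "\<not> (0 < u \<and> f x < f a \<or> 0 < v \<and> f y < f a)"
    proof -
      have "u = 0 \<or> x = a" "v = 0 \<or> y = a"
        using that xy uv by auto
      then have "u *\<^sub>R x = u *\<^sub>R a" "v *\<^sub>R y = v *\<^sub>R a"
        by auto
      then have "u *\<^sub>R x + v *\<^sub>R y = (u + v) *\<^sub>R a"
        by (simp only: scaleR_left_distrib)
      then show ?thesis
        using uv by simp
    qed
    ultimately show "u *\<^sub>R x + v *\<^sub>R y \<in> ?T"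
      by blast
  qed
  then have "convex hull S \<subseteq> ?T"
    using lt by (intro hull_minimal) auto
  then show ?thesis
    using x by auto
qed

text \<open>On route vectors this counts the edges shared with \<open>P\<close>, so among routes it
  is maximal only at \<open>P\<close> itself. The factor 1 matches the form of
  \<open>linear_lookup_sum\<close>.\<close>

definition overlap :: "route \<Rightarrow> (edge \<Rightarrow>\<^sub>0 real) \<Rightarrow> real" where
  "overlap P v = (\<Sum>e\<in>set P. 1 * Poly_Mapping.lookup v e)"

lemma linear_overlap: "linear (overlap P)"
  unfolding overlap_def[abs_def] by (rule linear_lookup_sum)

lemma overlap_less:
  assumes "composition s" "P \<in> routes s" "Q \<in> routes s" "P \<noteq> Q"
  shows "overlap P (route_vec Q) < overlap P (route_vec P)"
proof -
  have "overlap P (route_vec R) = card (set P \<inter> set R)" for R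
    by (simp add: overlap_def lookup_route_vec sum.If_cases)
  moreover have "set P \<inter> set Q \<subset> set P"
    using routes_inclusion_eq[OF assms(1-3)] assms(4) by blast
  ultimately show ?thesis
    by (simp add: psubset_card_mono)
qed

lemma route_vec_in_hull:
  assumes s: "composition s" and P: "P \<in> routes s" and C: "C \<subseteq> routes s"
    and hull: "route_vec P \<in> convex hull (route_vec ` C)"
  shows "P \<in> C"
proof (rule ccontr)
  assume "P \<notin> C"
  then have "overlap P (route_vec P) < overlap P (route_vec P)"
    using C overlap_less[OF s P] 
    by (intro convex_hull_linear_less[OF linear_overlap _ hull]) auto
  then show False
    by simp
qed

text \<open>Admissibility only describes projections of lower faces. Since \<open>overlap P\<close>
  exposes the vertex \<open>route_vec P\<close>, the lifted polytope has a single point above it,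
  and the height can be recovered from the projection.\<close>

lemma lifted_route_height:
  assumes s: "composition s" and P: "P \<in> routes s" and y: "(route_vec P, y) \<in> lifted s h"
  shows "y = h P"
proof -
  let ?f = "\<lambda>p :: (edge \<Rightarrow>\<^sub>0 real) \<times> real. overlap P (fst p)"
  have "linear ?f"
    using linear_compose[OF linear_fst linear_overlap] by (simp add: o_def)
  from convex_hull_exposed_point[OF this _ y[unfolded lifted_def], of "(route_vec P, h P)"]
  show ?thesis
    using overlap_less[OF s P] by force
qed

lemma lower_face_route_iff:
  assumes "linear c" "P \<in> routes s"
  shows "(route_vec P, h P) \<in> {p \<in> lifted s h. \<forall>q\<in>lifted s h. c (fst p) + snd p \<le> c (fst q) + snd q} \<longleftrightarrow>
    (\<forall>Q\<in>routes s. c (route_vec P) + h P \<le> c (route_vec Q) + h Q)"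
proof -
  have mem: "(route_vec Q, h Q) \<in> lifted s h" if "Q \<in> routes s" for Q
    unfolding lifted_def using that by (intro hull_inc) auto
  have "linear (\<lambda>p. c (fst p) + snd p)"
    using linear_compose_add[OF linear_compose[OF linear_fst assms(1)] linear_snd] by (simp add: o_def)
  note ge = convex_hull_linear_ge[OF this]
  have "c (route_vec P) + h P \<le> c (fst q) + snd q"
    if "\<forall>Q\<in>routes s. c (route_vec P) + h P \<le> c (route_vec Q) + h Q" "q \<in> lifted s h" for q
    using that(1) by (intro ge[OF _ that(2)[unfolded lifted_def]]) auto
  then show ?thesis
    using mem mem[OF assms(2)] by fastforce
qed

text \<open>The minimisers of \<open>c\<close> plus height span a lower face, whose projection is
  the hull of some clique; a route vector lies in such a hull only if its route belongs to the
  clique.\<close>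

lemma admissible_minimizers_coherent:
  assumes s: "composition s" and adm: "admissible s h" and c: "linear c"
    and P: "P \<in> routes s" "\<And>R. R \<in> routes s \<Longrightarrow> c (route_vec P) + h P \<le> c (route_vec R) + h R"
    and Q: "Q \<in> routes s" "\<And>R. R \<in> routes s \<Longrightarrow> c (route_vec Q) + h Q \<le> c (route_vec R) + h R"
  shows "coherent s P Q"
proof -
  define F where "F = {p \<in> lifted s h. \<forall>q\<in>lifted s h. c (fst p) + snd p \<le> c (fst q) + snd q}"
  have mem: "(route_vec P, h P) \<in> F" "(route_vec Q, h Q) \<in> F"
    unfolding F_def lower_face_route_iff[OF c P(1)] lower_face_route_iff[OF c Q(1)] using P Q by auto
  then have "F \<in> lower_faces (lifted s h)"
    unfolding lower_faces_def using c F_def by blast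
  then have "fst ` F \<in> DKK s"
    using adm unfolding admissible_def by blast
  then obtain C where C: "fst ` F = convex hull (route_vec ` C)" "C \<subseteq> routes s"
    "\<forall>P\<in>C. \<forall>Q\<in>C. coherent s P Q"
    unfolding DKK_def by blast
  have "route_vec P \<in> fst ` F" "route_vec Q \<in> fst ` F"
    using mem by force+
  then have "P \<in> C" "Q \<in> C"
    using route_vec_in_hull[OF s P(1) C(2)] route_vec_in_hull[OF s Q(1) C(2)] C(1) by auto
  then show ?thesis
    using C(3) by blast
qed

text \<open>The converse use of admissibility: the hull of a clique is the projection of a lower
  face, and the functional defining that face has no minimising route outside the clique.\<close>

lemma admissible_clique_functional:
  assumes s: "composition s" and adm: "admissible s h"
    and C: "C \<noteq> {}" "C \<subseteq> routes s" "\<And>P Q. P \<in> C \<Longrightarrow> Q \<in> C \<Longrightarrow> coherent s P Q"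
  obtains c where "linear c"
    "\<And>P. P \<in> routes s \<Longrightarrow>
      P \<in> C \<longleftrightarrow> (\<forall>Q\<in>routes s. c (route_vec P) + h P \<le> c (route_vec Q) + h Q)"
proof -
  have "convex hull (route_vec ` C) \<in> DKK s"
    unfolding DKK_def using C by blast
  then obtain F where F: "F \<in> lower_faces (lifted s h)" "fst ` F = convex hull (route_vec ` C)"
    using adm unfolding admissible_def by (metis (no_types, lifting) imageE)
  then obtain c where c: "linear c"
    "F = {p \<in> lifted s h. \<forall>q\<in>lifted s h. c (fst p) + snd p \<le> c (fst q) + snd q}"
    unfolding lower_faces_def by blast
  have "P \<in> C \<longleftrightarrow> (route_vec P, h P) \<in> F" if P: "P \<in> routes s" for P
  proof
    assume "P \<in> C"
    then have "route_vec P \<in> fst ` F"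
      unfolding F(2) by (intro hull_inc) auto
    then obtain y where y: "(route_vec P, y) \<in> F"
      by force
    then have "y = h P"
      using lifted_route_height[OF s P] c(2) by blast
    then show "(route_vec P, h P) \<in> F"
      using y by simp
  next
    assume "(route_vec P, h P) \<in> F"
    then have "route_vec P \<in> fst ` F"
      by force
    then show "P \<in> C"
      unfolding F(2) by (rule route_vec_in_hull[OF s P C(2)])
  qed
  then show thesis
    using that[OF c(1)] lower_face_route_iff[OF c(1)] unfolding c(2) by blast
qed

section \<open>Active routes\<close>

lemma binary_nonempty: "binary k \<noteq> {}"
  by (auto simp: binary_def PiE_eq_empty_iff)

lemma trop_poly_le: "\<delta> \<in> binary k \<Longrightarrow> trop_poly s h k t x \<le> trop_term s h k t x \<delta>"
  unfolding trop_poly_def by (intro Min_le) (auto intro: finite_binary)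

lemma trop_poly_attained: "\<exists>\<delta>\<in>binary k. trop_term s h k t x \<delta> = trop_poly s h k t x"
proof -
  have "trop_poly s h k t x \<in> trop_term s h k t x ` binary k"
    unfolding trop_poly_def using finite_binary binary_nonempty by (intro Min_in) auto
  then show ?thesis
    by auto
qed

lemma trop_poly_eqI:
  assumes "\<delta> \<in> binary k" "\<And>\<epsilon>. \<epsilon> \<in> binary k \<Longrightarrow> trop_term s h k t x \<delta> \<le> trop_term s h k t x \<epsilon>"
  shows "trop_poly s h k t x = trop_term s h k t x \<delta>"
  using trop_poly_attained[of k s h t x] trop_poly_le[OF assms(1), of s h t x] assms(2) by force

text \<open>Under the Cayley trick these are the routes on the lower face selected by
  \<open>x\<close>, once the source edge weights are adjusted so that every
  \<open>F\<^sup>k\<^sub>t\<close> has minimum 0.\<close>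

definition active :: "nat list \<Rightarrow> (route \<Rightarrow> real) \<Rightarrow> (nat \<Rightarrow>\<^sub>0 real) \<Rightarrow> route set" where
  "active s h x = {route_of s k t \<delta> | k t \<delta>. (k, t) \<in> route_indices s \<and> \<delta> \<in> binary k \<and>
     trop_term s h k t x \<delta> = trop_poly s h k t x}"

lemma route_of_active_iff:
  assumes "composition s" "(k, t) \<in> route_indices s" "\<delta> \<in> binary k"
  shows "route_of s k t \<delta> \<in> active s h x \<longleftrightarrow> trop_term s h k t x \<delta> = trop_poly s h k t x"
  using assms route_of_eqD[OF assms(1,2) _ assms(3)] unfolding active_def by blast

lemma activeE:
  assumes "P \<in> active s h x"
  obtains k t \<delta> where "(k, t) \<in> route_indices s" "\<delta> \<in> binary k" "P = route_of s k t \<delta>"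
    "trop_term s h k t x \<delta> = trop_poly s h k t x"
  using assms unfolding active_def by blast

lemma active_subset_routes: "composition s \<Longrightarrow> active s h x \<subseteq> routes s"
  by (auto elim!: activeE intro: route_of_in_routes)

lemma linear_route_of:
  assumes "linear (c :: (edge \<Rightarrow>\<^sub>0 real) \<Rightarrow> real)"
  shows "c (route_vec (route_of s k t \<delta>)) = c (Poly_Mapping.single (k, t) 1) +
    (\<Sum>i\<in>{1..<k}. c (Poly_Mapping.single (i, \<delta> i * part s i) 1))"
proof -
  have set: "set (route_of s k t \<delta>) = insert (k, t) ((\<lambda>i. (i, \<delta> i * part s i)) ` {1..<k})"
    by (auto simp: route_of_def)
  have "c (route_vec (route_of s k t \<delta>)) = (\<Sum>e\<in>set (route_of s k t \<delta>). c (Poly_Mapping.single e 1))"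
    unfolding route_vec_def by (rule linear_sum[OF assms])
  also have "\<dots> = c (Poly_Mapping.single (k, t) 1) +
      (\<Sum>e\<in>(\<lambda>i. (i, \<delta> i * part s i)) ` {1..<k}. c (Poly_Mapping.single e 1))"
    unfolding set by (subst sum.insert) auto
  also have "(\<Sum>e\<in>(\<lambda>i. (i, \<delta> i * part s i)) ` {1..<k}. c (Poly_Mapping.single e 1)) =
      (\<Sum>i\<in>{1..<k}. c (Poly_Mapping.single (i, \<delta> i * part s i) 1))"
    by (subst sum.reindex) (auto simp: inj_on_def)
  finally show ?thesis .
qed

lemma active_coherent:
  assumes s: "composition s" and adm: "admissible s h" and PQ: "P \<in> active s h x" "Q \<in> active s h x"
  shows "coherent s P Q"
proof -
  \<comment> \<open>Source edges get the negated minimum, bumps 0 and dips \<open>x i\<close>. A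
    route then has total weight plus height equal to its term minus the minimum of its polynomial,
    which is nonnegative and vanishes exactly on the active routes.\<close>
  define W where "W = (\<lambda>(i, j). if 0 < j \<and> j < part s i then - trop_poly s h i j x
    else if j = 0 then 0 else Poly_Mapping.lookup x i)"
  define c where "c v = (\<Sum>e\<in>edges s. W e * Poly_Mapping.lookup v e)" for v :: "edge \<Rightarrow>\<^sub>0 real"
  have lin: "linear c"
    unfolding c_def[abs_def] by (rule linear_lookup_sum)
  have single: "c (Poly_Mapping.single e 1) = W e" if "e \<in> edges s" for e
    using that finite_edges[of s] by (simp add: c_def lookup_single when_def mult_delta_right)
  have val: "c (route_vec (route_of s k t \<delta>)) + h (route_of s k t \<delta>) =
      trop_term s h k t x \<delta> - trop_poly s h k t x"
    if kt: "(k, t) \<in> route_indices s" and \<delta>: "\<delta> \<in> binary k" for k t \<delta>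
  proof -
    have "W (i, \<delta> i * part s i) = real (\<delta> i) * Poly_Mapping.lookup x i \<and> (i, \<delta> i * part s i) \<in> edges s"
      if i: "i \<in> {1..<k}" for i
    proof -
      have "i \<in> {1..length s}"
        using i kt by (auto simp: route_indices_def)
      then show ?thesis
        using binary_cases[OF \<delta> i] part_pos[OF s, of i] by (auto simp: W_def edges_def)
    qed
    moreover have "W (k, t) = - trop_poly s h k t x" "(k, t) \<in> edges s"
      using kt by (auto simp: W_def edges_def route_indices_def)
    ultimately show ?thesis
      by (simp add: linear_route_of[OF lin] single trop_term_def)
  qed
  have min: "c (route_vec P) + h P \<le> c (route_vec R) + h R"
    if P: "P \<in> active s h x" and R: "R \<in> routes s" for P R
  proof -
    obtain k t \<delta> where "(k, t) \<in> route_indices s" "\<delta> \<in> binary k" "R = route_of s k t \<delta>"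
      using R by (rule routesE[OF s])
    then have "0 \<le> c (route_vec R) + h R"
      using val trop_poly_le by simp
    moreover have "c (route_vec P) + h P = 0"
      using P val by (auto elim!: activeE)
    ultimately show ?thesis
      by simp
  qed
  show ?thesis
    using min PQ active_subset_routes[OF s, of h x]
    by (intro admissible_minimizers_coherent[OF s adm lin]) auto
qed

section \<open>From cliques back to points\<close>

lemma lookup_sum_single:
  assumes "finite A"
  shows "Poly_Mapping.lookup (\<Sum>i\<in>A. Poly_Mapping.single i (g i)) j = (if j \<in> A then g j else 0)"
  using assms by (simp add: lookup_sum lookup_single when_def)

lemma sum_single_in_Rn: "(\<Sum>i\<in>{1..n}. Poly_Mapping.single i (g i)) \<in> Rn n"
  by (auto simp: Rn_def in_keys_iff lookup_sum_single split: if_splits)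

lemma clique_affine_support:
  assumes s: "composition s" and adm: "admissible s h"
    and C: "C \<noteq> {}" "C \<subseteq> routes s" "\<And>P Q. P \<in> C \<Longrightarrow> Q \<in> C \<Longrightarrow> coherent s P Q"
  shows "\<exists>x Y. x \<in> Rn (length s) \<and>
    (\<forall>k t \<delta>. (k, t) \<in> route_indices s \<longrightarrow> \<delta> \<in> binary k \<longrightarrow> 0 \<le> trop_term s h k t x \<delta> + Y k t \<and>
      (route_of s k t \<delta> \<in> C \<longleftrightarrow> trop_term s h k t x \<delta> + Y k t = 0))"
proof -
  obtain c where lin: "linear c" and
    c: "\<And>P. P \<in> routes s \<Longrightarrow>
      P \<in> C \<longleftrightarrow> (\<forall>Q\<in>routes s. c (route_vec P) + h P \<le> c (route_vec Q) + h Q)"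
    using admissible_clique_functional[OF s adm C] by blast
  obtain P where P: "P \<in> C"
    using C(1) by blast
  define W where "W i j = c (Poly_Mapping.single (i, j) 1)" for i j
  define \<mu> where "\<mu> = c (route_vec P) + h P"
  \<comment> \<open>Dip weight minus bump weight. Subtracting the bump weights of all superscripts
    below \<open>k\<close> costs a constant, which \<open>Y\<close> absorbs together with the source
    edge weight and the minimum \<open>\<mu>\<close>.\<close>
  define x where "x = (\<Sum>i\<in>{1..length s}. Poly_Mapping.single i (W i (part s i) - W i 0))"
  define Y where "Y k t = W k t + (\<Sum>i\<in>{1..<k}. W i 0) - \<mu>" for k t
  have val: "c (route_vec (route_of s k t \<delta>)) + h (route_of s k t \<delta>) - \<mu> =
      trop_term s h k t x \<delta> + Y k t"
    if kt: "(k, t) \<in> route_indices s" and \<delta>: "\<delta> \<in> binary k" for k t \<delta>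
  proof -
    have "W i (\<delta> i * part s i) = W i 0 + real (\<delta> i) * Poly_Mapping.lookup x i" if i: "i \<in> {1..<k}" for i
    proof -
      have "i \<in> {1..length s}"
        using i kt by (auto simp: route_indices_def)
      then show ?thesis
        using binary_cases[OF \<delta> i] by (auto simp: x_def lookup_sum_single)
    qed
    then have "(\<Sum>i\<in>{1..<k}. W i (\<delta> i * part s i)) =
        (\<Sum>i\<in>{1..<k}. W i 0) + (\<Sum>i\<in>{1..<k}. real (\<delta> i) * Poly_Mapping.lookup x i)"
      by (simp add: sum.distrib)
    then show ?thesis
      by (simp add: linear_route_of[OF lin] W_def[symmetric] trop_term_def Y_def)
  qed
  have min: "\<mu> \<le> c (route_vec R) + h R" if "R \<in> routes s" for R
    using c[of P] P C(2) that by (auto simp: \<mu>_def)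
  have eq: "R \<in> C \<longleftrightarrow> c (route_vec R) + h R - \<mu> = 0" if R: "R \<in> routes s" for R
  proof
    assume "R \<in> C"
    then have "c (route_vec R) + h R \<le> \<mu>"
      using c[OF R] P C(2) by (auto simp: \<mu>_def)
    then show "c (route_vec R) + h R - \<mu> = 0"
      using min[OF R] by simp
  next
    assume "c (route_vec R) + h R - \<mu> = 0"
    then show "R \<in> C"
      using c[OF R] min by auto
  qed
  have "0 \<le> trop_term s h k t x \<delta> + Y k t \<and>
      (route_of s k t \<delta> \<in> C \<longleftrightarrow> trop_term s h k t x \<delta> + Y k t = 0)"
    if kt: "(k, t) \<in> route_indices s" "\<delta> \<in> binary k" for k t \<delta>
    using min[OF route_of_in_routes[OF s kt]] eq[OF route_of_in_routes[OF s kt]] val[OF kt] by simp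
  moreover have "x \<in> Rn (length s)"
    unfolding x_def by (rule sum_single_in_Rn)
  ultimately show ?thesis
    by blast
qed

definition prefix_routes :: "nat list \<Rightarrow> nat list \<Rightarrow> route set" where
  "prefix_routes s w = (\<lambda>p. prefix_route s (take p w)) ` {..length w}"

lemma prefix_route_route_of:
  fixes p :: nat
  assumes s: "composition s" and w: "w \<in> stirling_words s 1"
  defines "u \<equiv> take p w"
  defines "c \<equiv> prefix_index s u" and "\<delta> \<equiv> restrict (\<lambda>i. count_list u i div part s i) {1..<prefix_index s u}"
  shows "(c, level s u c) \<in> route_indices s" "\<delta> \<in> binary c" "prefix_route s u = route_of s c (level s u c) \<delta>"
proof -
  have le: "count_list u a \<le> part s a" for a
    unfolding u_def by (rule count_take_part_le[OF w])
  show "(c, level s u c) \<in> route_indices s"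
    using prefix_profile[OF s le] by (auto simp: c_def route_indices_def profile_def)
  show "\<delta> \<in> binary c"
    unfolding binary_def \<delta>_def c_def using count_div_part(2)[OF s _ le] by (intro PiE_I) auto
  show "prefix_route s u = route_of s c (level s u c) \<delta>"
    by (auto simp: prefix_route_def Let_def route_of_def c_def[symmetric] \<delta>_def level_def)
qed

text \<open>Activity of a route says that its height is the minimum of its polynomial less the
  linear part, which is the hypothesis of the telescoping lemma with \<open>Y\<close> the negated
  minima. The resulting coordinates depend on \<open>w\<close> alone, so any two such points of
  \<open>Rn\<close> coincide.\<close>

lemma active_coordinates:
  assumes s: "composition s" and w: "w \<in> stirling_words s 1" and a: "a \<in> {1..length s}"
    and sub: "prefix_routes s w \<subseteq> active s h x"
  shows "Poly_Mapping.lookup x a = (\<Sum>t\<in>{1..part s a}. h (prefix_route s (take (occ_pos w a t) w))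
      - h (prefix_route s (take (occ_pos w a t + 1) w)))"
proof (rule prefix_route_telescope[OF s w a, where Y = "\<lambda>k t. - trop_poly s h k t x", symmetric])
  fix p assume "p \<le> length w"
  then have "prefix_route s (take p w) \<in> active s h x"
    using sub by (auto simp: prefix_routes_def)
  note r = prefix_route_route_of[OF s w, of p] and this[unfolded prefix_route_route_of(3)[OF s w]]
  from this(4) have "trop_term s h (prefix_index s (take p w)) (level s (take p w) (prefix_index s (take p w))) x
      (restrict (\<lambda>i. count_list (take p w) i div part s i) {1..<prefix_index s (take p w)}) =
      trop_poly s h (prefix_index s (take p w)) (level s (take p w) (prefix_index s (take p w))) x"
    unfolding route_of_active_iff[OF s r(1,2)] .
  then show "h (prefix_route s (take p w)) =
      - (- trop_poly s h (prefix_index s (take p w)) (level s (take p w) (prefix_index s (take p w))) x +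
        (\<Sum>i\<in>{1..<prefix_index s (take p w)}. real (count_list (take p w) i div part s i) * Poly_Mapping.lookup x i))"
    unfolding trop_term_def r(3)[symmetric] by simp
qed

text \<open>The prefix ending with the \<open>t\<close>-th letter \<open>k\<close> works, since all
  smaller letters are then untouched or used up; for \<open>k = n + 1\<close> the empty prefix
  does.\<close>

lemma prefix_routes_hit:
  assumes s: "composition s" and w: "w \<in> stirling_words s 1" and kt: "(k, t) \<in> route_indices s"
  shows "\<exists>\<delta>\<in>binary k. route_of s k t \<delta> \<in> prefix_routes s w"
proof -
  have "\<exists>p\<le>length w. prefix_index s (take p w) = k \<and> level s (take p w) k = t"
  proof (cases "k = length s + 1")
    case True
    then have "t = 1"
      using kt by (auto simp: route_indices_def part_last)
    moreover have "prefix_index s [] = k"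
      unfolding True by (rule prefix_index_eqI) auto
    ultimately show ?thesis
      using True by (intro exI[of _ 0]) (auto simp: level_def)
  next
    case False
    then have k: "k \<in> {1..length s}" and t: "t \<in> {1..part s k - 1}"
      using kt by (auto simp: route_indices_def)
    have cw: "count_list w b = part s b" if "b \<in> {1..length s}" for b
      using w that by (auto simp: stirling_words_def)
    define p where "p = occ_pos w k t"
    have p: "p < length w" "w ! p = k" "count_list (take p w) k = t - 1"
      using occ_pos_props[of t w k] t cw[OF k] by (auto simp: p_def)
    have ct: "count_list (take (Suc p) w) k = t"
      using count_take_Suc[OF p(1), of k] p t by auto
    have "prefix_index s (take (Suc p) w) = k"
    proof (rule prefix_index_eqI)
      fix i assume i: "i \<in> {1..<k}"
      then show "\<not> is_open s (take (Suc p) w) i"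
        using smaller_letter_closed[of w p i] w p(1,2) cw[of i] k count_take_Suc[OF p(1), of i]
        by (auto simp: stirling_words_def)
    qed (use k t ct in auto)
    then show ?thesis
      using p(1) ct False by (intro exI[of _ "Suc p"]) (auto simp: level_def)
  qed
  then obtain p where p: "p \<le> length w" "prefix_index s (take p w) = k" "level s (take p w) k = t"
    by blast
  note r = prefix_route_route_of[OF s w, of p, unfolded p(2,3)]
  have "prefix_route s (take p w) \<in> prefix_routes s w"
    using p(1) by (simp add: prefix_routes_def)
  then show ?thesis
    using r(2) unfolding r(3) by (intro bexI)
qed

lemma stirling_word_point:
  assumes s: "composition s" and adm: "admissible s h" and w: "w \<in> stirling_words s 1"
  shows "\<exists>x\<in>Rn (length s). active s h x = prefix_routes s w"
proof -
  have C: "prefix_routes s w \<noteq> {}" "prefix_routes s w \<subseteq> routes s"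
    using prefix_route_in_routes[OF s w] by (auto simp: prefix_routes_def)
  have coh: "coherent s P Q" if "P \<in> prefix_routes s w" "Q \<in> prefix_routes s w" for P Q
    using that prefix_routes_coherent[OF s w] by (auto simp: prefix_routes_def)
  obtain x Y where x: "x \<in> Rn (length s)"
    and ge: "\<And>k t \<delta>. (k, t) \<in> route_indices s \<Longrightarrow> \<delta> \<in> binary k \<Longrightarrow> 0 \<le> trop_term s h k t x \<delta> + Y k t"
    and iff: "\<And>k t \<delta>. (k, t) \<in> route_indices s \<Longrightarrow> \<delta> \<in> binary k \<Longrightarrow>
      route_of s k t \<delta> \<in> prefix_routes s w \<longleftrightarrow> trop_term s h k t x \<delta> + Y k t = 0"
    using clique_affine_support[OF s adm C coh] by blast
  \<comment> \<open>The supporting constant is only a lower bound for the terms until some term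
    attains it; the clique provides one for each \<open>(k, t)\<close>.\<close>
  have poly: "trop_poly s h k t x = - Y k t" if kt: "(k, t) \<in> route_indices s" for k t
  proof -
    obtain \<delta> where \<delta>: "\<delta> \<in> binary k" "route_of s k t \<delta> \<in> prefix_routes s w"
      using prefix_routes_hit[OF s w kt] by blast
    then have eq: "trop_term s h k t x \<delta> = - Y k t"
      using iff[OF kt] by fastforce
    have "trop_poly s h k t x = trop_term s h k t x \<delta>"
      using ge[OF kt] eq \<delta>(1) by (intro trop_poly_eqI) force+
    then show ?thesis
      using eq by simp
  qed
  have "P \<in> active s h x \<longleftrightarrow> P \<in> prefix_routes s w" if P: "P \<in> routes s" for P
    using P
  proof (rule routesE[OF s])
    fix k t \<delta> assume r: "(k, t) \<in> route_indices s" "\<delta> \<in> binary k" "P = route_of s k t \<delta>"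
    show ?thesis
      unfolding r(3) route_of_active_iff[OF s r(1,2)] iff[OF r(1,2)] poly[OF r(1)] by auto
  qed
  then show ?thesis
    using C(2) active_subset_routes[OF s, of h x] x by blast
qed

section \<open>Regions of the arrangement\<close>

lemma bounded_linear_lookup: "bounded_linear (\<lambda>x :: 'a \<Rightarrow>\<^sub>0 real. Poly_Mapping.lookup x i)"
proof (rule bounded_linear_intro[where K = 1])
  fix x :: "'a \<Rightarrow>\<^sub>0 real"
  have "norm x = (\<Sum>j\<in>Poly_Mapping.keys x. \<bar>Poly_Mapping.lookup x j\<bar>)"
    by (simp add: norm_poly_mapping_def dist_poly_mapping_def)
  moreover have "\<bar>Poly_Mapping.lookup x i\<bar> \<le> (\<Sum>j\<in>Poly_Mapping.keys x. \<bar>Poly_Mapping.lookup x j\<bar>)"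
    if "i \<in> Poly_Mapping.keys x"
    using that by (intro member_le_sum) auto
  ultimately show "norm (Poly_Mapping.lookup x i) \<le> norm x * 1"
    by (cases "i \<in> Poly_Mapping.keys x") (auto simp: in_keys_iff)
qed (simp_all add: lookup_add lookup_scaleR)

lemma continuous_on_trop_term: "continuous_on A (\<lambda>x. trop_term s h k t x \<delta>)"
  unfolding trop_term_def
  by (intro continuous_intros bounded_linear.continuous_on[OF bounded_linear_lookup])

lemma trop_term_affine:
  assumes "u + v = 1"
  shows "trop_term s h k t (u *\<^sub>R x + v *\<^sub>R y) \<delta> = u * trop_term s h k t x \<delta> + v * trop_term s h k t y \<delta>"
proof -
  have "h (route_of s k t \<delta>) = u * h (route_of s k t \<delta>) + v * h (route_of s k t \<delta>)"
    using assms by (metis distrib_right mult_1)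
  then show ?thesis
    unfolding trop_term_def
    by (simp add: lookup_add lookup_scaleR distrib_left sum.distrib sum_distrib_left mult.left_commute)
qed

lemma trop_term_shift:
  "trop_term s h k t (x + r *\<^sub>R d) \<delta> =
    trop_term s h k t x \<delta> + r * (\<Sum>i\<in>{1..<k}. real (\<delta> i) * Poly_Mapping.lookup d i)"
  unfolding trop_term_def
  by (simp add: lookup_add lookup_scaleR sum.distrib sum_distrib_left algebra_simps)

lemma Rn_alt: "Rn n = {x. \<forall>i\<in>- {1..n}. Poly_Mapping.lookup x i = 0}"
  by (auto simp: Rn_def in_keys_iff)

lemma Rn_comb: "x \<in> Rn n \<Longrightarrow> y \<in> Rn n \<Longrightarrow> u *\<^sub>R x + v *\<^sub>R y \<in> Rn n"
  by (simp add: Rn_alt lookup_add lookup_scaleR)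

lemma Rn_eqI:
  assumes "x \<in> Rn n" "y \<in> Rn n" "\<And>i. i \<in> {1..n} \<Longrightarrow> Poly_Mapping.lookup x i = Poly_Mapping.lookup y i"
  shows "x = y"
proof (rule poly_mapping_eqI)
  fix i show "Poly_Mapping.lookup x i = Poly_Mapping.lookup y i"
    using assms by (cases "i \<in> {1..n}") (auto simp: Rn_alt)
qed

lemma closed_Rn: "closed (Rn n)"
proof -
  have "Rn n = (\<Inter>i\<in>- {1..n}. {x. Poly_Mapping.lookup x i = 0})"
    by (auto simp: Rn_alt)
  also have "closed \<dots>"
    by (intro closed_INT ballI closed_Collect_eq continuous_on_const
        linear_continuous_on bounded_linear_lookup)
  finally show ?thesis .
qed

section \<open>Regions as choices of one minimal term per polynomial\<close>

definition selector :: "nat list \<Rightarrow> (nat \<times> nat \<Rightarrow> nat \<Rightarrow> nat) \<Rightarrow> bool" where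
  "selector s \<sigma> \<longleftrightarrow> (\<forall>(k, t)\<in>route_indices s. \<sigma> (k, t) \<in> binary k)"

text \<open>Kept apart from \<open>Rn\<close> because this set is open in the ambient space of
  finitely supported functions, as the connectedness argument for components requires.\<close>

definition strict_halfspaces ::
  "nat list \<Rightarrow> (route \<Rightarrow> real) \<Rightarrow> (nat \<times> nat \<Rightarrow> nat \<Rightarrow> nat) \<Rightarrow> (nat \<Rightarrow>\<^sub>0 real) set" where
  "strict_halfspaces s h \<sigma> = {x. \<forall>(k, t)\<in>route_indices s. \<forall>\<delta>\<in>binary k - {\<sigma> (k, t)}.
     trop_term s h k t x (\<sigma> (k, t)) < trop_term s h k t x \<delta>}"

definition region ::
  "nat list \<Rightarrow> (route \<Rightarrow> real) \<Rightarrow> (nat \<times> nat \<Rightarrow> nat \<Rightarrow> nat) \<Rightarrow> (nat \<Rightarrow>\<^sub>0 real) set" where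
  "region s h \<sigma> = Rn (length s) \<inter> strict_halfspaces s h \<sigma>"

definition closed_region ::
  "nat list \<Rightarrow> (route \<Rightarrow> real) \<Rightarrow> (nat \<times> nat \<Rightarrow> nat \<Rightarrow> nat) \<Rightarrow> (nat \<Rightarrow>\<^sub>0 real) set" where
  "closed_region s h \<sigma> = Rn (length s) \<inter> {x. \<forall>(k, t)\<in>route_indices s. \<forall>\<delta>\<in>binary k.
     trop_term s h k t x (\<sigma> (k, t)) \<le> trop_term s h k t x \<delta>}"

abbreviation complement :: "nat list \<Rightarrow> (route \<Rightarrow> real) \<Rightarrow> (nat \<Rightarrow>\<^sub>0 real) set" where
  "complement s h \<equiv> Rn (length s) - \<Union>(arrangement s h)"

lemma strict_halfspacesD:
  assumes "x \<in> strict_halfspaces s h \<sigma>" "(k, t) \<in> route_indices s" "\<delta> \<in> binary k" "\<delta> \<noteq> \<sigma> (k, t)"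
  shows "trop_term s h k t x (\<sigma> (k, t)) < trop_term s h k t x \<delta>"
proof -
  have "\<forall>\<delta>\<in>binary k - {\<sigma> (k, t)}. trop_term s h k t x (\<sigma> (k, t)) < trop_term s h k t x \<delta>"
    using assms(1,2) unfolding strict_halfspaces_def by blast
  then show ?thesis
    using assms(3,4) by simp
qed

lemma open_strict_halfspaces: "open (strict_halfspaces s h \<sigma>)"
proof -
  have "strict_halfspaces s h \<sigma> = (\<Inter>(k, t)\<in>route_indices s. \<Inter>\<delta>\<in>binary k - {\<sigma> (k, t)}.
      {x. trop_term s h k t x (\<sigma> (k, t)) < trop_term s h k t x \<delta>})"
    by (auto simp: strict_halfspaces_def)
  also have "open \<dots>"
    using finite_route_indices finite_binary
    by (auto intro!: open_INT open_Collect_less continuous_on_trop_term)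
  finally show ?thesis .
qed

lemma closed_closed_region: "closed (closed_region s h \<sigma>)"
proof -
  have "closed_region s h \<sigma> = Rn (length s) \<inter> (\<Inter>(k, t)\<in>route_indices s. \<Inter>\<delta>\<in>binary k.
      {x. trop_term s h k t x (\<sigma> (k, t)) \<le> trop_term s h k t x \<delta>})"
    by (auto simp: closed_region_def)
  also have "closed \<dots>"
    by (auto intro!: closed_Int closed_Rn closed_INT closed_Collect_le continuous_on_trop_term)
  finally show ?thesis .
qed

lemma region_combination:
  assumes x: "x \<in> closed_region s h \<sigma>" and y: "y \<in> region s h \<sigma>" and \<sigma>: "selector s \<sigma>"
    and uv: "0 \<le> u" "0 < v" "u + v = 1"
  shows "u *\<^sub>R x + v *\<^sub>R y \<in> region s h \<sigma>"
proof -
  have "trop_term s h k t (u *\<^sub>R x + v *\<^sub>R y) (\<sigma> (k, t)) < trop_term s h k t (u *\<^sub>R x + v *\<^sub>R y) \<delta>"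
    if "(k, t) \<in> route_indices s" "\<delta> \<in> binary k - {\<sigma> (k, t)}" for k t \<delta>
  proof -
    have "u * trop_term s h k t x (\<sigma> (k, t)) \<le> u * trop_term s h k t x \<delta>"
      using x that uv by (intro mult_left_mono) (auto simp: closed_region_def)
    moreover have "v * trop_term s h k t y (\<sigma> (k, t)) < v * trop_term s h k t y \<delta>"
      using y that uv by (intro mult_strict_left_mono) (auto simp: region_def strict_halfspaces_def)
    ultimately show ?thesis
      unfolding trop_term_affine[OF uv(3)] by linarith
  qed
  then show ?thesis
    using x y by (auto simp: region_def strict_halfspaces_def closed_region_def intro!: Rn_comb)
qed

lemma region_subset_closed_region: "region s h \<sigma> \<subseteq> closed_region s h \<sigma>"
proof
  fix x assume x: "x \<in> region s h \<sigma>"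
  have "trop_term s h k t x (\<sigma> (k, t)) \<le> trop_term s h k t x \<delta>"
    if "(k, t) \<in> route_indices s" "\<delta> \<in> binary k" for k t \<delta>
  proof (cases "\<delta> = \<sigma> (k, t)")
    case False
    then show ?thesis
      using x strict_halfspacesD[of x s h \<sigma> k t \<delta>] that by (simp add: region_def)
  qed simp
  then show "x \<in> closed_region s h \<sigma>"
    using x by (auto simp: region_def closed_region_def)
qed

lemma convex_region: "selector s \<sigma> \<Longrightarrow> convex (region s h \<sigma>)"
proof (rule convexI)
  fix x y and u v :: real
  assume "selector s \<sigma>" "x \<in> region s h \<sigma>" "y \<in> region s h \<sigma>" "0 \<le> u" "0 \<le> v" "u + v = 1"
  then show "u *\<^sub>R x + v *\<^sub>R y \<in> region s h \<sigma>"
    using region_combination[of x s h \<sigma> y u v] region_subset_closed_region[of s h \<sigma>]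
    by (cases "v = 0") auto
qed

text \<open>Moving a point of the closed region slightly towards a point of the open one makes all
  weak inequalities strict.\<close>

lemma closure_region:
  assumes \<sigma>: "selector s \<sigma>" and ne: "region s h \<sigma> \<noteq> {}"
  shows "closure (region s h \<sigma>) = closed_region s h \<sigma>"
proof
  show "closure (region s h \<sigma>) \<subseteq> closed_region s h \<sigma>"
    by (intro closure_minimal region_subset_closed_region closed_closed_region)
  show "closed_region s h \<sigma> \<subseteq> closure (region s h \<sigma>)"
  proof
    fix x assume x: "x \<in> closed_region s h \<sigma>"
    obtain y where y: "y \<in> region s h \<sigma>"
      using ne by blast
    define r where "r n = inverse (real (Suc n))" for n
    have "(\<lambda>n. (1 - r n) *\<^sub>R x + r n *\<^sub>R y) \<longlonglongrightarrow> (1 - 0) *\<^sub>R x + 0 *\<^sub>R y"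
      unfolding r_def by (intro tendsto_intros LIMSEQ_inverse_real_of_nat)
    moreover have "(1 - r n) *\<^sub>R x + r n *\<^sub>R y \<in> region s h \<sigma>" for n
      by (rule region_combination[OF x y \<sigma>]) (auto simp: r_def field_simps)
    ultimately show "x \<in> closure (region s h \<sigma>)"
      unfolding closure_sequential by (intro exI[of _ "\<lambda>n. (1 - r n) *\<^sub>R x + r n *\<^sub>R y"]) simp
  qed
qed

lemma closed_region_poly:
  assumes "selector s \<sigma>" "x \<in> closed_region s h \<sigma>" "(k, t) \<in> route_indices s"
  shows "trop_poly s h k t x = trop_term s h k t x (\<sigma> (k, t))"
  using assms by (intro trop_poly_eqI) (auto simp: selector_def closed_region_def)

text \<open>Selectors may differ outside \<open>route_indices s\<close>, so the conclusion equates
  the sets they define and not the selectors.\<close>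

lemma regions_agree:
  assumes "selector s \<sigma>" "selector s \<tau>" "x \<in> region s h \<sigma>" "x \<in> region s h \<tau>"
  shows "strict_halfspaces s h \<sigma> = strict_halfspaces s h \<tau>"
proof -
  have "\<sigma> (k, t) = \<tau> (k, t)" if kt: "(k, t) \<in> route_indices s" for k t
  proof (rule ccontr)
    assume "\<sigma> (k, t) \<noteq> \<tau> (k, t)"
    then have "\<tau> (k, t) \<in> binary k - {\<sigma> (k, t)}" "\<sigma> (k, t) \<in> binary k - {\<tau> (k, t)}"
      using assms(1,2) kt by (auto simp: selector_def)
    then have "trop_term s h k t x (\<sigma> (k, t)) < trop_term s h k t x (\<tau> (k, t))"
      "trop_term s h k t x (\<tau> (k, t)) < trop_term s h k t x (\<sigma> (k, t))"
      using assms(3,4) kt by (auto simp: region_def strict_halfspaces_def)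
    then show False
      by simp
  qed
  then show ?thesis
    unfolding strict_halfspaces_def by (intro Collect_cong ball_cong) auto
qed

section \<open>Regions are the components of the complement\<close>

lemma arrangement_member:
  assumes "x \<in> Rn (length s)" "(k, t) \<in> route_indices s" "\<delta> \<in> binary k" "\<epsilon> \<in> binary k" "\<delta> \<noteq> \<epsilon>"
    and "trop_term s h k t x \<delta> = trop_poly s h k t x" "trop_term s h k t x \<epsilon> = trop_poly s h k t x"
  shows "x \<in> \<Union>(arrangement s h)"
proof -
  \<comment> \<open>\<open>binary 1\<close> has a single element, so two distinct exponents put
    \<open>k\<close> in the range of the arrangement.\<close>
  have "k \<noteq> 1"
    using assms(3-5) by (auto simp: binary_def)
  then have "trop_hypersurface s h k t \<in> arrangement s h"
    using assms(2) unfolding arrangement_def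
    by (intro CollectI exI[of _ k] exI[of _ t]) (auto simp: route_indices_def)
  moreover have "x \<in> trop_hypersurface s h k t"
    unfolding trop_hypersurface_def
    by (intro CollectI conjI bexI[of _ \<delta>] bexI[of _ \<epsilon>]) (use assms in simp_all)
  ultimately show ?thesis
    by blast
qed

lemma complement_eq: "complement s h = (\<Union>\<sigma>\<in>Collect (selector s). region s h \<sigma>)"
proof (intro set_eqI iffI)
  fix x assume x: "x \<in> complement s h"
  define \<sigma> where "\<sigma> = (\<lambda>(k, t). SOME \<delta>. \<delta> \<in> binary k \<and> trop_term s h k t x \<delta> = trop_poly s h k t x)"
  have \<sigma>: "\<sigma> (k, t) \<in> binary k \<and> trop_term s h k t x (\<sigma> (k, t)) = trop_poly s h k t x" for k t
  proof -
    have "\<exists>\<delta>. \<delta> \<in> binary k \<and> trop_term s h k t x \<delta> = trop_poly s h k t x"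
      using trop_poly_attained by blast
    from someI_ex[OF this] show ?thesis
      by (simp add: \<sigma>_def)
  qed
  have "trop_term s h k t x (\<sigma> (k, t)) < trop_term s h k t x \<delta>"
    if "(k, t) \<in> route_indices s" "\<delta> \<in> binary k - {\<sigma> (k, t)}" for k t \<delta>
  proof -
    have "trop_term s h k t x \<delta> \<noteq> trop_poly s h k t x"
      using arrangement_member[of x s k t "\<sigma> (k, t)" \<delta> h] \<sigma>[of k t] that x by auto
    then show ?thesis
      using trop_poly_le[of \<delta> k s h t x] \<sigma>[of k t] that by simp
  qed
  then have "x \<in> region s h \<sigma>"
    using x by (auto simp: region_def strict_halfspaces_def)
  moreover have "selector s \<sigma>"
    using \<sigma> by (auto simp: selector_def)
  ultimately show "x \<in> (\<Union>\<sigma>\<in>Collect (selector s). region s h \<sigma>)"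
    by blast
next
  fix x assume "x \<in> (\<Union>\<sigma>\<in>Collect (selector s). region s h \<sigma>)"
  then obtain \<sigma> where \<sigma>: "selector s \<sigma>" and x: "x \<in> region s h \<sigma>"
    by blast
  have "\<delta> = \<sigma> (k, t)"
    if "k \<in> {2..length s + 1}" "t \<in> {1..part s k - 1}" "\<delta> \<in> binary k"
      "trop_term s h k t x \<delta> = trop_poly s h k t x" for k t \<delta>
  proof (rule ccontr)
    assume "\<delta> \<noteq> \<sigma> (k, t)"
    moreover have kt: "(k, t) \<in> route_indices s"
      using that by (auto simp: route_indices_def)
    ultimately have "trop_term s h k t x (\<sigma> (k, t)) < trop_term s h k t x \<delta>"
      using x that strict_halfspacesD[of x s h \<sigma> k t \<delta>] by (simp add: region_def)
    moreover have "\<sigma> (k, t) \<in> binary k"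
      using \<sigma> kt by (auto simp: selector_def)
    ultimately show False
      using trop_poly_le[of "\<sigma> (k, t)" k s h t x] that by simp
  qed
  then have "x \<notin> trop_hypersurface s h k t" if "k \<in> {2..length s + 1}" "t \<in> {1..part s k - 1}" for k t
    using that unfolding trop_hypersurface_def by blast
  then have "x \<notin> \<Union>(arrangement s h)"
    unfolding arrangement_def by blast
  then show "x \<in> complement s h"
    using x by (auto simp: region_def)
qed

lemma component_eq_region:
  assumes U: "U \<in> components (complement s h)" and \<sigma>: "selector s \<sigma>"
    and x: "x \<in> U" "x \<in> region s h \<sigma>"
  shows "U = region s h \<sigma>"
proof
  have "region s h \<sigma> \<subseteq> complement s h"
    unfolding complement_eq using \<sigma> by blast
  then show "region s h \<sigma> \<subseteq> U"
    using U x by (intro components_maximal[OF U] convex_connected convex_region[OF \<sigma>]) auto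
  \<comment> \<open>Together with the half-spaces of \<open>\<sigma>\<close>, this gives an open
    cover of \<open>U\<close> that would disconnect it. Disjointness is asked only inside
    \<open>Rn\<close>, which contains \<open>U\<close>.\<close>
  define B where "B = \<Union>{strict_halfspaces s h \<tau> | \<tau>. selector s \<tau> \<and> region s h \<sigma> \<inter> region s h \<tau> = {}}"
  have "open B"
    unfolding B_def using open_strict_halfspaces by blast
  have sub: "U \<subseteq> Rn (length s)" "U \<subseteq> (\<Union>\<sigma>\<in>Collect (selector s). region s h \<sigma>)"
    using in_components_subset[OF U] complement_eq[of s h] by auto
  have "strict_halfspaces s h \<sigma> \<inter> B \<inter> U = {}"
    using sub(1) by (auto simp: B_def region_def)
  moreover have "U \<subseteq> strict_halfspaces s h \<sigma> \<union> B"
  proof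
    fix y assume "y \<in> U"
    then obtain \<tau> where \<tau>: "selector s \<tau>" "y \<in> region s h \<tau>"
      using sub(2) by blast
    then have y: "y \<in> strict_halfspaces s h \<tau>"
      by (simp add: region_def)
    show "y \<in> strict_halfspaces s h \<sigma> \<union> B"
    proof (cases "region s h \<sigma> \<inter> region s h \<tau> = {}")
      case True
      then show ?thesis
        using y \<tau>(1) unfolding B_def by blast
    next
      case False
      then show ?thesis
        using y regions_agree[OF \<sigma> \<tau>(1)] by blast
    qed
  qed
  ultimately have "strict_halfspaces s h \<sigma> \<inter> U = {} \<or> B \<inter> U = {}"
    using connectedD[OF in_components_connected[OF U] open_strict_halfspaces[of s h \<sigma>] \<open>open B\<close>] by blast
  moreover have "x \<in> strict_halfspaces s h \<sigma> \<inter> U"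
    using x by (auto simp: region_def)
  ultimately have "U \<subseteq> strict_halfspaces s h \<sigma>"
    using \<open>U \<subseteq> strict_halfspaces s h \<sigma> \<union> B\<close> by blast
  then show "U \<subseteq> region s h \<sigma>"
    using sub(1) by (auto simp: region_def)
qed

lemma componentE:
  assumes "U \<in> components (complement s h)"
  obtains \<sigma> where "selector s \<sigma>" "U = region s h \<sigma>" "region s h \<sigma> \<noteq> {}"
proof -
  obtain x where x: "x \<in> U"
    using in_components_nonempty[OF assms] by blast
  then obtain \<sigma> where \<sigma>: "selector s \<sigma>" "x \<in> region s h \<sigma>"
    using in_components_subset[OF assms] complement_eq[of s h] by blast
  then show thesis
    using that[OF \<sigma>(1) component_eq_region[OF assms \<sigma>(1) x \<sigma>(2)]] by blast
qed

lemma region_in_components: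
  assumes \<sigma>: "selector s \<sigma>" and "region s h \<sigma> \<noteq> {}"
  shows "region s h \<sigma> \<in> components (complement s h)"
proof -
  obtain x where x: "x \<in> region s h \<sigma>"
    using assms by blast
  then have "x \<in> complement s h"
    unfolding complement_eq using \<sigma> by blast
  then have "x \<in> \<Union>(components (complement s h))"
    by (simp only: Union_components)
  then obtain U where U: "U \<in> components (complement s h)" "x \<in> U"
    by blast
  then have "U = region s h \<sigma>"
    using component_eq_region \<sigma> x by blast
  then show ?thesis
    using U(1) by simp
qed

section \<open>Regions around a given point\<close>

lemma sum_power2_inj:
  assumes "\<delta> \<in> binary k" "\<epsilon> \<in> binary k"
    and "(\<Sum>i\<in>{1..<k}. \<delta> i * 2 ^ i) = (\<Sum>i\<in>{1..<k}. \<epsilon> i * 2 ^ i)"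
  shows "\<delta> = \<epsilon>"
proof -
  \<comment> \<open>Reads the sum as a binary expansion, so that injectivity of
    \<open>set_encode\<close> on finite sets applies.\<close>
  have enc: "(\<Sum>i\<in>{1..<k}. \<gamma> i * 2 ^ i) = set_encode {i \<in> {1..<k}. \<gamma> i = 1}" if "\<gamma> \<in> binary k" for \<gamma>
  proof -
    have "(\<Sum>i\<in>{1..<k}. \<gamma> i * 2 ^ i) = (\<Sum>i\<in>{1..<k}. if \<gamma> i = 1 then 2 ^ i else 0)"
    proof (rule sum.cong)
      fix i assume "i \<in> {1..<k}"
      from binary_cases[OF that this] show "\<gamma> i * 2 ^ i = (if \<gamma> i = 1 then 2 ^ i else 0)"
        by auto
    qed simp
    also have "\<dots> = set_encode {i \<in> {1..<k}. \<gamma> i = 1}"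
      unfolding set_encode_def by (intro sum.inter_filter[symmetric]) simp
    finally show ?thesis .
  qed
  have "set_encode {i \<in> {1..<k}. \<delta> i = 1} = set_encode {i \<in> {1..<k}. \<epsilon> i = 1}"
    using assms(3) unfolding enc[OF assms(1)] enc[OF assms(2)] .
  then have "{i \<in> {1..<k}. \<delta> i = 1} = {i \<in> {1..<k}. \<epsilon> i = 1}"
    by (rule set_encode_eq[THEN iffD1, rotated 2]) auto
  then have iff: "\<delta> i = 1 \<longleftrightarrow> \<epsilon> i = 1" if "i \<in> {1..<k}" for i
    using that by blast
  have "\<delta> i = \<epsilon> i" if "i \<in> {1..<k}" for i
    using binary_cases[OF assms(1) that] binary_cases[OF assms(2) that] iff[OF that] by auto
  then show ?thesis
    using assms(1,2) by (intro PiE_ext) (auto simp: binary_def)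
qed

lemma eventually_affine_less:
  fixes a b c d :: real
  assumes "a < b"
  shows "eventually (\<lambda>r. a + r * c < b + r * d) (at 0 within S)"
proof -
  have "((\<lambda>r. (b + r * d) - (a + r * c)) \<longlongrightarrow> (b + 0 * d) - (a + 0 * c)) (at 0 within S)"
    by (intro tendsto_intros)
  then have "eventually (\<lambda>r. 0 < (b + r * d) - (a + r * c)) (at 0 within S)"
    using assms by (intro order_tendstoD(1)) auto
  then show ?thesis
    by eventually_elim simp
qed

text \<open>The direction \<open>(2\<^sup>1, \<dots>, 2\<^sup>n)\<close> separates all exponent vectors, so a small shift along it
  leads from any point into a region having that point in its closure.\<close>

lemma exists_region_around:
  assumes "x \<in> Rn (length s)"
  shows "\<exists>\<sigma>. selector s \<sigma> \<and> region s h \<sigma> \<noteq> {} \<and> x \<in> closed_region s h \<sigma>"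
proof -
  define d where "d = (\<Sum>i\<in>{1..length s}. Poly_Mapping.single i (2 ^ i :: real))"
  define slope where "slope k \<delta> = (\<Sum>i\<in>{1..<k}. \<delta> i * 2 ^ i)" for k and \<delta> :: "nat \<Rightarrow> nat"
  have d: "d \<in> Rn (length s)"
    unfolding d_def by (rule sum_single_in_Rn)
  have shift: "trop_term s h k t (x + r *\<^sub>R d) \<delta> = trop_term s h k t x \<delta> + r * real (slope k \<delta>)"
    if "(k, t) \<in> route_indices s" for k t \<delta> r
  proof -
    have "Poly_Mapping.lookup d i = 2 ^ i" if "i \<in> {1..<k}" for i
      using that \<open>(k, t) \<in> route_indices s\<close> by (auto simp: d_def lookup_sum_single route_indices_def)
    then show ?thesis
      by (simp add: trop_term_shift slope_def)
  qed
  \<comment> \<open>\<open>\<sigma>\<close> breaks ties among the terms minimal at \<open>x\<close>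
    by least slope along \<open>d\<close>. For small positive \<open>r\<close> these ties become
    strict because slopes differ, and inequalities already strict at \<open>x\<close>
    persist.\<close>
  define M where "M k t = {\<delta> \<in> binary k. trop_term s h k t x \<delta> = trop_poly s h k t x}" for k t
  have "\<exists>\<delta>. is_arg_min (slope k) (\<lambda>\<delta>. \<delta> \<in> M k t) \<delta>" for k t
    using trop_poly_attained[of k s h t x] finite_binary[of k]
    by (intro ex_is_arg_min_if_finite) (auto simp: M_def)
  then obtain \<sigma>' where \<sigma>': "\<And>k t. is_arg_min (slope k) (\<lambda>\<delta>. \<delta> \<in> M k t) (\<sigma>' k t)"
    by metis
  define \<sigma> where "\<sigma> = (\<lambda>(k, t). \<sigma>' k t)"
  have M: "\<sigma> (k, t) \<in> M k t" and least: "\<And>\<delta>. \<delta> \<in> M k t \<Longrightarrow> slope k (\<sigma> (k, t)) \<le> slope k \<delta>" for k t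
    using \<sigma>'[of k t] by (auto simp: is_arg_min_def \<sigma>_def not_less)
  have sel: "selector s \<sigma>"
    using M by (auto simp: selector_def M_def)
  have ev: "eventually (\<lambda>r. trop_term s h k t (x + r *\<^sub>R d) (\<sigma> (k, t)) < trop_term s h k t (x + r *\<^sub>R d) \<delta>) (at_right 0)"
    if kt: "(k, t) \<in> route_indices s" and \<delta>: "\<delta> \<in> binary k - {\<sigma> (k, t)}" for k t \<delta>
  proof (cases "\<delta> \<in> M k t")
    case True
    have "slope k (\<sigma> (k, t)) \<noteq> slope k \<delta>"
      using sum_power2_inj[of "\<sigma> (k, t)" k \<delta>] M[of k t] \<delta> by (auto simp: slope_def M_def)
    then have "slope k (\<sigma> (k, t)) < slope k \<delta>"
      using least[OF True] by simp
    moreover have "trop_term s h k t x (\<sigma> (k, t)) = trop_term s h k t x \<delta>"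
      using M[of k t] True by (simp add: M_def)
    ultimately show ?thesis
      unfolding shift[OF kt] by (intro eventually_mono[OF eventually_at_right_less[of 0]]) simp
  next
    case False
    then have "trop_term s h k t x (\<sigma> (k, t)) < trop_term s h k t x \<delta>"
      using M[of k t] \<delta> trop_poly_le[of \<delta> k s h t x] by (auto simp: M_def)
    then show ?thesis
      unfolding shift[OF kt] by (rule eventually_affine_less)
  qed
  have "eventually (\<lambda>r. \<forall>(k, t)\<in>route_indices s. \<forall>\<delta>\<in>binary k - {\<sigma> (k, t)}.
      trop_term s h k t (x + r *\<^sub>R d) (\<sigma> (k, t)) < trop_term s h k t (x + r *\<^sub>R d) \<delta>) (at_right 0)"
    unfolding split_beta
    by (intro eventually_ball_finite finite_route_indices finite_Diff finite_binary ballI)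
      (use ev in \<open>auto simp: split_beta\<close>)
  then have "eventually (\<lambda>r. x + r *\<^sub>R d \<in> region s h \<sigma>) (at_right 0)"
    using Rn_comb[OF assms d, of 1] by (simp add: region_def strict_halfspaces_def)
  then have "region s h \<sigma> \<noteq> {}"
    using eventually_happens'[OF trivial_limit_at_right_real] by blast
  moreover have "x \<in> closed_region s h \<sigma>"
    using assms M trop_poly_le[of _ _ s h _ x] by (auto simp: closed_region_def M_def)
  ultimately show ?thesis
    using sel by blast
qed

section \<open>Vertices\<close>

lemma active_closed_region_iff:
  assumes "composition s" "selector s \<sigma>" "x \<in> closed_region s h \<sigma>" "(k, t) \<in> route_indices s" "\<delta> \<in> binary k"
  shows "route_of s k t \<delta> \<in> active s h x \<longleftrightarrow> trop_term s h k t x \<delta> = trop_term s h k t x (\<sigma> (k, t))"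
  unfolding route_of_active_iff[OF assms(1,4,5)] closed_region_poly[OF assms(2-4)] ..

lemma closed_region_le:
  assumes "x \<in> closed_region s h \<sigma>" "(k, t) \<in> route_indices s" "\<delta> \<in> binary k"
  shows "trop_term s h k t x (\<sigma> (k, t)) \<le> trop_term s h k t x \<delta>"
  using assms by (auto simp: closed_region_def)

text \<open>If \<open>x\<close> lies between \<open>a\<close> and \<open>b\<close> in a closed
  region, the gap of each term to the selected one is nonnegative at both ends. A gap that is 0 at
  \<open>x\<close> is thus 0 at both ends, so routes active at \<open>x\<close> are active at
  \<open>a\<close> and \<open>b\<close>, and both equal \<open>x\<close>.\<close>

lemma vertex_if_determined:
  assumes s: "composition s" and x: "x \<in> Rn (length s)"
    and det: "\<And>y. y \<in> Rn (length s) \<Longrightarrow> active s h x \<subseteq> active s h y \<Longrightarrow> y = x"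
  shows "\<exists>U\<in>components (complement s h). {x} face_of closure U"
proof -
  obtain \<sigma> where \<sigma>: "selector s \<sigma>" and ne: "region s h \<sigma> \<noteq> {}" and xr: "x \<in> closed_region s h \<sigma>"
    using exists_region_around[OF x] by blast
  have "x \<notin> open_segment a b" if ab: "a \<in> closed_region s h \<sigma>" "b \<in> closed_region s h \<sigma>" for a b
  proof
    assume "x \<in> open_segment a b"
    then obtain u where u: "0 < u" "u < 1" "x = (1 - u) *\<^sub>R a + u *\<^sub>R b" and "a \<noteq> b"
      by (auto simp: in_segment)
    have "P \<in> active s h a \<and> P \<in> active s h b" if "P \<in> active s h x" for P
    proof -
      obtain k t \<delta> where r: "(k, t) \<in> route_indices s" "\<delta> \<in> binary k" and P: "P = route_of s k t \<delta>"
        using \<open>P \<in> active s h x\<close> by (rule activeE)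
      define da where "da = trop_term s h k t a \<delta> - trop_term s h k t a (\<sigma> (k, t))"
      define db where "db = trop_term s h k t b \<delta> - trop_term s h k t b (\<sigma> (k, t))"
      have "trop_term s h k t x \<delta> = trop_term s h k t x (\<sigma> (k, t))"
        using that unfolding P active_closed_region_iff[OF s \<sigma> xr r] .
      moreover have "trop_term s h k t x \<gamma> = (1 - u) * trop_term s h k t a \<gamma> + u * trop_term s h k t b \<gamma>" for \<gamma>
        unfolding u(3) by (rule trop_term_affine) simp
      ultimately have sum: "(1 - u) * da + u * db = 0"
        by (simp add: da_def db_def algebra_simps)
      have nonneg: "0 \<le> da" "0 \<le> db"
        using closed_region_le[OF ab(1) r] closed_region_le[OF ab(2) r] by (simp_all add: da_def db_def)
      then have "0 \<le> (1 - u) * da" "0 \<le> u * db"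
        using u by simp_all
      then have "(1 - u) * da = 0" "u * db = 0"
        using sum by linarith+
      then show ?thesis
        unfolding P active_closed_region_iff[OF s \<sigma> ab(1) r] active_closed_region_iff[OF s \<sigma> ab(2) r]
        using u by (simp add: da_def db_def)
    qed
    then have "a = x" "b = x"
      using ab by (intro det; auto simp: closed_region_def)+
    then show False
      using \<open>a \<noteq> b\<close> by simp
  qed
  then have "{x} face_of closure (region s h \<sigma>)"
    using xr by (simp add: face_of_singleton extreme_point_of_def closure_region[OF \<sigma> ne])
  then show ?thesis
    using region_in_components[OF \<sigma> ne] by blast
qed

text \<open>Points on the line from \<open>x\<close> to \<open>z\<close> close to \<open>x\<close>,
  on either side, stay in the closed region: ties at \<open>x\<close> are also ties at
  \<open>z\<close> and hence hold along the line, while strict inequalities survive small moves. If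
  \<open>z\<close> were different, \<open>x\<close> would be a midpoint.\<close>

lemma vertex_determined:
  assumes s: "composition s" and U: "U \<in> components (complement s h)" and face: "{x} face_of closure U"
    and z: "z \<in> Rn (length s)" "active s h x \<subseteq> active s h z"
  shows "z = x"
proof (rule ccontr)
  assume "z \<noteq> x"
  obtain \<sigma> where \<sigma>: "selector s \<sigma>" and ne: "region s h \<sigma> \<noteq> {}" and "U = region s h \<sigma>"
    using U by (rule componentE)
  then have ext: "x extreme_point_of closed_region s h \<sigma>"
    using face by (simp add: face_of_singleton closure_region[OF \<sigma> ne])
  then have x: "x \<in> closed_region s h \<sigma>"
    by (simp add: extreme_point_of_def)
  then have xR: "x \<in> Rn (length s)"
    by (simp add: closed_region_def)
  define y where "y r = (1 - r) *\<^sub>R x + r *\<^sub>R z" for r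
  have term_y: "trop_term s h k t (y r) \<delta> =
      trop_term s h k t x \<delta> + r * (trop_term s h k t z \<delta> - trop_term s h k t x \<delta>)" for k t r \<delta>
    unfolding y_def by (subst trop_term_affine) (simp_all add: algebra_simps)
  \<comment> \<open>The filter is two-sided, since the extreme point is to be contradicted by moving
    both towards \<open>z\<close> and away from it.\<close>
  have ev: "eventually (\<lambda>r. trop_term s h k t (y r) (\<sigma> (k, t)) \<le> trop_term s h k t (y r) \<delta>) (at 0)"
    if r: "(k, t) \<in> route_indices s" "\<delta> \<in> binary k" for k t \<delta>
  proof (cases "route_of s k t \<delta> \<in> active s h x")
    case True
    have \<sigma>r: "\<sigma> (k, t) \<in> binary k"
      using \<sigma> r by (auto simp: selector_def)
    have "route_of s k t (\<sigma> (k, t)) \<in> active s h x"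
      unfolding active_closed_region_iff[OF s \<sigma> x r(1) \<sigma>r] ..
    then have "trop_term s h k t z \<delta> = trop_term s h k t z (\<sigma> (k, t))"
      using True z(2) route_of_active_iff[OF s r, of h z] route_of_active_iff[OF s r(1) \<sigma>r, of h z] by auto
    then have "trop_term s h k t (y r) \<delta> = trop_term s h k t (y r) (\<sigma> (k, t))" for r
      unfolding term_y using True active_closed_region_iff[OF s \<sigma> x r] by simp
    then show ?thesis
      by simp
  next
    case False
    then have "trop_term s h k t x (\<sigma> (k, t)) < trop_term s h k t x \<delta>"
      using active_closed_region_iff[OF s \<sigma> x r] closed_region_le[OF x r] by simp
    from eventually_affine_less[OF this] show ?thesis
      unfolding term_y by (rule eventually_mono) (erule less_imp_le)
  qed
  have "eventually (\<lambda>r. \<forall>(k, t)\<in>route_indices s. \<forall>\<delta>\<in>binary k.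
      trop_term s h k t (y r) (\<sigma> (k, t)) \<le> trop_term s h k t (y r) \<delta>) (at 0)"
    unfolding split_beta
    by (intro eventually_ball_finite finite_route_indices finite_binary ballI)
      (use ev in \<open>auto simp: split_beta\<close>)
  then have "eventually (\<lambda>r. y r \<in> closed_region s h \<sigma>) (at 0)"
    using Rn_comb[OF xR z(1)] by (simp add: closed_region_def y_def)
  then obtain e where e: "0 < e" "\<And>r. r \<noteq> 0 \<Longrightarrow> \<bar>r\<bar> < e \<Longrightarrow> y r \<in> closed_region s h \<sigma>"
    by (auto simp: eventually_at dist_real_def)
  define r where "r = e / 2"
  have yq: "y q = x + q *\<^sub>R (z - x)" for q
    by (simp add: y_def algebra_simps)
  have "y r \<in> closed_region s h \<sigma>" "y (- r) \<in> closed_region s h \<sigma>"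
    using e(1) by (auto intro!: e(2) simp: r_def)
  moreover have "x \<in> open_segment (y (- r)) (y r)"
  proof -
    have "y (- r) \<noteq> y r"
    proof
      assume "y (- r) = y r"
      then show False
        using \<open>z \<noteq> x\<close> e(1) by (simp add: yq r_def del: scaleR_minus_left)
    qed
    moreover have "x = midpoint (y (- r)) (y r)"
    proof -
      have "y (- r) + y r = 2 *\<^sub>R x"
        by (simp add: yq scaleR_2)
      then show ?thesis
        by (simp add: midpoint_def)
    qed
    ultimately show ?thesis
      by simp
  qed
  ultimately show False
    using ext unfolding extreme_point_of_def by blast
qed

text \<open>A singleton is bounded and nonempty, so a vertex of the bounded complex is simply an
  extreme point of the closure of some region.\<close>

lemma complex_vertices_Perm:
  "complex_vertices (Perm s h) = {x. \<exists>U\<in>components (complement s h). {x} face_of closure U}"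
  by (simp add: complex_vertices_def Perm_def induced_cells_def)

theorem theorem6p34:
  fixes s :: "nat list" and h :: "route \<Rightarrow> real"
  assumes "composition s"
    and "admissible s h"
  shows "\<exists>v :: nat list \<Rightarrow> (nat \<Rightarrow>\<^sub>0 real).
    bij_betw v (stirling_perms s) (complex_vertices (Perm s h)) \<and>
    (\<forall>w\<in>stirling_perms s. \<forall>a\<in>{1..length s}.
       Poly_Mapping.lookup (v w) a =
         (\<Sum>t\<in>{1..part s a}.
            h (prefix_route s (take (occ_pos w a t) w))
            - h (prefix_route s (take (occ_pos w a t + 1) w))))"
proof -
  note s = assms(1) and adm = assms(2)
  have "\<forall>w\<in>stirling_words s 1. \<exists>x. x \<in> Rn (length s) \<and> active s h x = prefix_routes s w"
    using stirling_word_point[OF s adm] by blast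
  then obtain v where v: "\<And>w. w \<in> stirling_words s 1 \<Longrightarrow> v w \<in> Rn (length s)"
    "\<And>w. w \<in> stirling_words s 1 \<Longrightarrow> active s h (v w) = prefix_routes s w"
    by metis
  \<comment> \<open>An active set containing that of \<open>v w\<close> contains
    \<open>C\<^sub>w\<close>, whose equations already fix every coordinate.\<close>
  have unique: "y = v w"
    if w: "w \<in> stirling_words s 1" and y: "y \<in> Rn (length s)" "active s h (v w) \<subseteq> active s h y" for w y
  proof (rule Rn_eqI[OF y(1) v(1)[OF w]])
    fix a assume a: "a \<in> {1..length s}"
    show "Poly_Mapping.lookup y a = Poly_Mapping.lookup (v w) a"
      using active_coordinates[OF s w a, of h y] active_coordinates[OF s w a, of h "v w"] y(2) v(2)[OF w]
      by simp
  qed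
  have "inj_on v (stirling_words s 1)"
  proof (rule inj_onI)
    fix w w' assume w: "w \<in> stirling_words s 1" "w' \<in> stirling_words s 1" and "v w = v w'"
    then have "prefix_routes s w = prefix_routes s w'"
      using v(2)[OF w(1)] v(2)[OF w(2)] by simp
    then show "w = w'"
      using stirling_word_eqI[OF s w] by (simp add: prefix_routes_def)
  qed
  moreover have "v ` stirling_words s 1 = complex_vertices (Perm s h)"
    unfolding complex_vertices_Perm
  proof (intro equalityI subsetI)
    fix x assume "x \<in> v ` stirling_words s 1"
    then obtain w where w: "w \<in> stirling_words s 1" and x: "x = v w"
      by blast
    show "x \<in> {x. \<exists>U\<in>components (complement s h). {x} face_of closure U}"
      using vertex_if_determined[OF s v(1)[OF w] unique[OF w]] by (simp add: x)
  next
    fix x assume "x \<in> {x. \<exists>U\<in>components (complement s h). {x} face_of closure U}"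
    then obtain U where U: "U \<in> components (complement s h)" "{x} face_of closure U"
      by blast
    obtain w where w: "w \<in> stirling_words s 1" "active s h x \<subseteq> prefix_routes s w"
      using clique_subset_prefix_routes[OF s active_subset_routes[OF s, of h x] active_coherent[OF s adm, where x = x]]
      by (auto simp: prefix_routes_def)
    \<comment> \<open>The active set of \<open>x\<close> lies inside \<open>C\<^sub>w\<close>, which
      is the active set of \<open>v w\<close>; the vertex \<open>x\<close> is determined by its own
      active set, so the two points coincide.\<close>
    have "v w = x"
      using vertex_determined[OF s U v(1)[OF w(1)]] w v(2) by simp
    then show "x \<in> v ` stirling_words s 1"
      using w(1) by blast
  qed
  ultimately have "bij_betw v (stirling_perms s) (complex_vertices (Perm s h))"
    by (simp add: bij_betw_def stirling_perms_eq)
  moreover have "\<forall>w\<in>stirling_perms s. \<forall>a\<in>{1..length s}.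
       Poly_Mapping.lookup (v w) a =
         (\<Sum>t\<in>{1..part s a}.
            h (prefix_route s (take (occ_pos w a t) w))
            - h (prefix_route s (take (occ_pos w a t + 1) w)))"
    using active_coordinates[OF s] v(2) by (simp add: stirling_perms_eq)
  ultimately show ?thesis
    by blast
qed

end
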